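(* $\mathsf{RaPar}(\mathcal C,\mathcal S)$ is a split range category, with its range structure defined by $$\widehat{[s,f]_{\mathrm z^\circ}}=[s_f,s_f]_{\mathrm z^\circ}$$ for all $\mathcal S$-spans $(s,f)$, where $s_f$ belongs to the $(\mathcal P,\mathcal S)$-factorization $f=s_f\cdot p_f$ of $f$.
   Context: Standing assumptions: $\mathcal C$ is a category and $\mathcal S$ is a class of morphisms of $\mathcal C$ such that pullbacks of $\mathcal S$-morphisms along arbitrary morphisms exist in $\mathcal C$ and belong to $\mathcal S$, and $\mathcal S$ belongs to a relatively stable orthogonal factorization system $(\mathcal P,\mathcal S)$ of $\mathcal C$, i.e. $\mathcal P$ is stable under pullback along $\mathcal S$-morphisms. (In particular $\mathcal S$ contains all isomorphisms and is closed under composition.) For every $f$, $f=s_f\cdot p_f$ denotes a chosen factorization with $s_f\in\mathcal S$, $p_f\in\mathcal P$. $\mathcal S$-spans: an $\mathcal S$-span $(s,f):A\to B$ is a pair $s:D\to A$ in $\mathcal S$, $f:D\to B$ in $\mathcal C$; a morphism $x:(s,f)\to(\tilde s,\tilde f)$ is a $\mathcal C$-morphism with $\tilde s\cdot x=s$, $\tilde f\cdot x=f$; isomorphic spans are identified; they form the category $\mathsf{Span}(\mathcal C,\mathcal S)$ (with the objects of $\mathcal C$) under $(t,g)\cdot(s,f)=(s\cdot t',g\cdot f')$, where $f\cdot t'=t\cdot f'$ is a pullback square. The class $\mathcal S^\star$: an $\mathcal S$-cospan $\langle f,s\rangle:A\to B$ is a pair $f:A\to D$ in $\mathcal C$, $s:B\to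 D$ in $\mathcal S$; a morphism $v:\langle f,s\rangle\to\langle g,t\rangle$ is a $\mathcal C$-morphism with $v\cdot f=g$, $v\cdot s=t$; with pullback squares $f\cdot s'=s\cdot f'$ and $g\cdot t'=t\cdot g'$, its conjugate $v^\star$ is the unique morphism with $t'\cdot v^\star=s'$, $g'\cdot v^\star=f'$. $\mathcal S^\star$ is the class of all existing pullbacks in $\mathcal C$ of conjugates $v^\star$ of $\mathcal S$-cospan morphisms $v$ with $v\in\mathcal S$; here $\mathcal S^\star\subseteq\mathcal S$. The class $\mathcal S^\circ$ is the least pullback-stable class $\mathcal T$ with $\mathcal S^\star\subseteq\mathcal T\subseteq\mathcal S$ satisfying the $(\mathcal P,\mathcal S)$-stability property: for all $p,q\in\mathcal P$, $x\in\mathcal S$, $y\in\mathcal T$, if $x\cdot q=p\cdot y$ then $x\in\mathcal T$. $\sim_{\mathrm z^\circ}$ is the least equivalence relation on $\mathcal S$-spans such that $(s,f)\sim_{\mathrm z^\circ}(\tilde s,\tilde f)$ whenever there is a morphism $x:(s,f)\to(\tilde s,\tilde f)$ with $x\in\mathcal S^\circ$; it is a congruence. $\mathsf{RaPar}(\mathcal C,\mathcal S)$ is the quotient category of $\mathsf{Span}(\mathcal C,\mathcal S)$ by $\sim_{\mathrm z^\circ}$, with morphisms $[s,f]_{\mathrm z^\circ}$. Its restriction structure is $\overline{[s,f]_{\mathrm z^\circ}}=[s,s]_{\mathrm z^\circ}$. Restriction and range categories: a restriction structure on a category assigns to each $f:A\to B$ a morphism $\bar f:A\to A$ such that (R1)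 $f\cdot\bar f=f$; (R2) $\bar f\cdot\bar g=\bar g\cdot\bar f$ if $\mathrm{dom}f=\mathrm{dom}g$; (R3) $\overline{g\cdot\bar f}=\bar g\cdot\bar f$ if $\mathrm{dom}f=\mathrm{dom}g$; (R4) $\bar g\cdot f=f\cdot\overline{g\cdot f}$ if $\mathrm{cod}f=\mathrm{dom}g$. It is split if every $e$ with $\bar e=e$ splits ($e=m\cdot r$, $r\cdot m=1$ for some $m,r$). A range structure on a restriction category assigns to each $f:A\to B$ a morphism $\widehat f:B\to B$ such that (RR1) $\overline{\widehat f}=\widehat f$; (RR2) $\widehat f\cdot f=f$; (RR3) $\widehat{\bar g\cdot f}=\bar g\cdot\widehat f$ if $\mathrm{cod}f=\mathrm{dom}g$; (RR4) $\widehat{g\cdot\widehat f}=\widehat{g\cdot f}$ if $\mathrm{cod}f=\mathrm{dom}g$. A restriction category with a range structure is a range category; it is split if it is split as a restriction category. *)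

theory Defs
  imports Main
begin

record ('o, 'm) cat =
  Obj :: "'o set"
  Arr :: "'m set"
  Dom :: "'m \<Rightarrow> 'o"
  Cod :: "'m \<Rightarrow> 'o"
  Id :: "'o \<Rightarrow> 'm"
  Comp :: "'m \<Rightarrow> 'm \<Rightarrow> 'm"  (infixr "\<cdot>\<index>" 75)

definition Hom :: "('o, 'm) cat \<Rightarrow> 'o \<Rightarrow> 'o \<Rightarrow> 'm set" where
  "Hom C A B = {f \<in> Arr C. Dom C f = A \<and> Cod C f = B}"

text \<open>\<open>g \<cdot> f\<close> is meaningful only for arrows with \<open>Dom g = Cod f\<close>.\<close>

locale category =
  fixes C :: "('o, 'm) cat" (structure)
  assumes Dom_closed: "f \<in> Arr C \<Longrightarrow> Dom C f \<in> Obj C"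
    and Cod_closed: "f \<in> Arr C \<Longrightarrow> Cod C f \<in> Obj C"
    and Id_Hom: "A \<in> Obj C \<Longrightarrow> Id C A \<in> Hom C A A"
    and Comp_Hom: "\<lbrakk>f \<in> Hom C A B; g \<in> Hom C B D\<rbrakk> \<Longrightarrow> g \<cdot> f \<in> Hom C A D"
    and Comp_assoc: "\<lbrakk>f \<in> Hom C A B; g \<in> Hom C B D; h \<in> Hom C D E\<rbrakk>
      \<Longrightarrow> (h \<cdot> g) \<cdot> f = h \<cdot> (g \<cdot> f)"
    and Comp_Id_right: "f \<in> Hom C A B \<Longrightarrow> f \<cdot> Id C A = f"
    and Comp_Id_left: "f \<in> Hom C A B \<Longrightarrow> Id C B \<cdot> f = f"

definition is_iso :: "('o, 'm) cat \<Rightarrow> 'm \<Rightarrow> bool" where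
  "is_iso C f \<longleftrightarrow> f \<in> Arr C \<and> (\<exists>g \<in> Hom C (Cod C f) (Dom C f).
     g \<cdot>\<^bsub>C\<^esub> f = Id C (Dom C f) \<and> f \<cdot>\<^bsub>C\<^esub> g = Id C (Cod C f))"

text \<open>\<open>is_pullback C f t t' f'\<close>: the square \<open>f \<cdot> t' = t \<cdot> f'\<close> is a pullback, so \<open>t'\<close> is
  a pullback of \<open>t\<close> along \<open>f\<close>, and \<open>f'\<close> is a pullback of \<open>f\<close> along \<open>t\<close>.\<close>

definition is_pullback :: "('o, 'm) cat \<Rightarrow> 'm \<Rightarrow> 'm \<Rightarrow> 'm \<Rightarrow> 'm \<Rightarrow> bool" where
  "is_pullback C f t t' f' \<longleftrightarrow>
     f \<in> Arr C \<and> t \<in> Arr C \<and> Cod C f = Cod C t \<and>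
     t' \<in> Hom C (Dom C t') (Dom C f) \<and> f' \<in> Hom C (Dom C t') (Dom C t) \<and>
     f \<cdot>\<^bsub>C\<^esub> t' = t \<cdot>\<^bsub>C\<^esub> f' \<and>
     (\<forall>X. \<forall>u \<in> Hom C X (Dom C f). \<forall>v \<in> Hom C X (Dom C t).
        f \<cdot>\<^bsub>C\<^esub> u = t \<cdot>\<^bsub>C\<^esub> v \<longrightarrow>
        (\<exists>!w. w \<in> Hom C X (Dom C t') \<and> t' \<cdot>\<^bsub>C\<^esub> w = u \<and> f' \<cdot>\<^bsub>C\<^esub> w = v))"

definition pullback_stable :: "('o, 'm) cat \<Rightarrow> 'm set \<Rightarrow> bool" where
  "pullback_stable C T \<longleftrightarrow>
     (\<forall>f t t' f'. is_pullback C f t t' f' \<and> t \<in> T \<longrightarrow> t' \<in> T)"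

definition has_pullbacks_of :: "('o, 'm) cat \<Rightarrow> 'm set \<Rightarrow> bool" where
  "has_pullbacks_of C T \<longleftrightarrow>
     (\<forall>f \<in> Arr C. \<forall>t \<in> T. Cod C f = Cod C t \<longrightarrow> (\<exists>t' f'. is_pullback C f t t' f'))"

definition is_factorization ::
  "('o, 'm) cat \<Rightarrow> 'm set \<Rightarrow> 'm set \<Rightarrow> 'm \<Rightarrow> 'm \<Rightarrow> 'm \<Rightarrow> bool" where
  "is_factorization C P S f s p \<longleftrightarrow>
     p \<in> P \<and> s \<in> S \<and> Cod C p = Dom C s \<and> f = s \<cdot>\<^bsub>C\<^esub> p"

definition orthogonal_factorization_system ::
  "('o, 'm) cat \<Rightarrow> 'm set \<Rightarrow> 'm set \<Rightarrow> bool" where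
  "orthogonal_factorization_system C P S \<longleftrightarrow>
     P \<subseteq> Arr C \<and> S \<subseteq> Arr C \<and>
     (\<forall>i. is_iso C i \<longrightarrow> i \<in> P \<and> i \<in> S) \<and>
     (\<forall>p \<in> P. \<forall>q \<in> P. Dom C q = Cod C p \<longrightarrow> q \<cdot>\<^bsub>C\<^esub> p \<in> P) \<and>
     (\<forall>s \<in> S. \<forall>t \<in> S. Dom C t = Cod C s \<longrightarrow> t \<cdot>\<^bsub>C\<^esub> s \<in> S) \<and>
     (\<forall>f \<in> Arr C. \<exists>s p. is_factorization C P S f s p) \<and>
     (\<forall>p \<in> P. \<forall>s \<in> S. \<forall>u \<in> Hom C (Dom C p) (Dom C s). \<forall>v \<in> Hom C (Cod C p) (Cod C s).
        s \<cdot>\<^bsub>C\<^esub> u = v \<cdot>\<^bsub>C\<^esub> p \<longrightarrow>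
        (\<exists>!d. d \<in> Hom C (Cod C p) (Dom C s) \<and> d \<cdot>\<^bsub>C\<^esub> p = u \<and> s \<cdot>\<^bsub>C\<^esub> d = v))"

definition relatively_stable :: "('o, 'm) cat \<Rightarrow> 'm set \<Rightarrow> 'm set \<Rightarrow> bool" where
  "relatively_stable C P S \<longleftrightarrow>
     (\<forall>p s s' p'. is_pullback C p s s' p' \<and> p \<in> P \<and> s \<in> S \<longrightarrow> p' \<in> P)"

definition spans :: "('o, 'm) cat \<Rightarrow> 'm set \<Rightarrow> ('m \<times> 'm) set" where
  "spans C S = {(s, f). s \<in> S \<and> f \<in> Arr C \<and> Dom C s = Dom C f}"

definition span_mor :: "('o, 'm) cat \<Rightarrow> 'm \<Rightarrow> 'm \<times> 'm \<Rightarrow> 'm \<times> 'm \<Rightarrow> bool" where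
  "span_mor C x = (\<lambda>(s, f) (s1, f1).
     x \<in> Hom C (Dom C s) (Dom C s1) \<and> s1 \<cdot>\<^bsub>C\<^esub> x = s \<and> f1 \<cdot>\<^bsub>C\<^esub> x = f)"

definition span_iso :: "('o, 'm) cat \<Rightarrow> 'm set \<Rightarrow> (('m \<times> 'm) \<times> ('m \<times> 'm)) set" where
  "span_iso C S = {(a, b). a \<in> spans C S \<and> b \<in> spans C S \<and>
     (\<exists>x. span_mor C x a b \<and> is_iso C x)}"

text \<open>An arrow of \<open>Span C S\<close> is an isomorphism class of spans.  The domain and codomain of
  a span do not depend on its representative; neither does the class of a composite, nor on
  the chosen pullback, so the union below is a union of equal classes.\<close>

definition Span :: "('o, 'm) cat \<Rightarrow> 'm set \<Rightarrow> ('o, ('m \<times> 'm) set) cat" where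
  "Span C S = \<lparr>
     Obj = Obj C,
     Arr = spans C S // span_iso C S,
     Dom = (\<lambda>a. the_elem ((\<lambda>(s, f). Cod C s) ` a)),
     Cod = (\<lambda>a. the_elem ((\<lambda>(s, f). Cod C f) ` a)),
     Id = (\<lambda>A. span_iso C S `` {(Id C A, Id C A)}),
     Comp = (\<lambda>b a. \<Union>{span_iso C S `` {(s \<cdot>\<^bsub>C\<^esub> t', g \<cdot>\<^bsub>C\<^esub> f')} | s f t g t' f'.
               (s, f) \<in> a \<and> (t, g) \<in> b \<and> is_pullback C f t t' f'}) \<rparr>"

definition cospans :: "('o, 'm) cat \<Rightarrow> 'm set \<Rightarrow> ('m \<times> 'm) set" where
  "cospans C S = {(f, s). f \<in> Arr C \<and> s \<in> S \<and> Cod C f = Cod C s}"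

definition cospan_mor :: "('o, 'm) cat \<Rightarrow> 'm \<Rightarrow> 'm \<times> 'm \<Rightarrow> 'm \<times> 'm \<Rightarrow> bool" where
  "cospan_mor C v = (\<lambda>(f, s) (g, t).
     v \<in> Hom C (Cod C f) (Cod C g) \<and> v \<cdot>\<^bsub>C\<^esub> f = g \<and> v \<cdot>\<^bsub>C\<^esub> s = t)"

text \<open>\<open>is_conjugate C S v c d w\<close>: for the morphism \<open>v\<close> from the cospan \<open>c\<close> to the cospan \<open>d\<close>,
  \<open>w\<close> is the conjugate of \<open>v\<close> with respect to some choice of the two pullback squares.
  Different choices change \<open>w\<close> by isomorphisms only.\<close>

definition is_conjugate ::
  "('o, 'm) cat \<Rightarrow> 'm set \<Rightarrow> 'm \<Rightarrow> 'm \<times> 'm \<Rightarrow> 'm \<times> 'm \<Rightarrow> 'm \<Rightarrow> bool" where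
  "is_conjugate C S v c d w \<longleftrightarrow>
     c \<in> cospans C S \<and> d \<in> cospans C S \<and> cospan_mor C v c d \<and>
     (\<exists>s' f' t' g'. is_pullback C (fst c) (snd c) s' f' \<and> is_pullback C (fst d) (snd d) t' g' \<and>
        w \<in> Hom C (Dom C s') (Dom C t') \<and> t' \<cdot>\<^bsub>C\<^esub> w = s' \<and> g' \<cdot>\<^bsub>C\<^esub> w = f')"

definition S_star :: "('o, 'm) cat \<Rightarrow> 'm set \<Rightarrow> 'm set" where
  "S_star C S = {y. \<exists>v c d w h h'. v \<in> S \<and> is_conjugate C S v c d w \<and> is_pullback C h w y h'}"

definition factor_stable :: "('o, 'm) cat \<Rightarrow> 'm set \<Rightarrow> 'm set \<Rightarrow> 'm set \<Rightarrow> bool" where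
  "factor_stable C P S T \<longleftrightarrow>
     (\<forall>p \<in> P. \<forall>q \<in> P. \<forall>x \<in> S. \<forall>y \<in> T.
        Dom C x = Cod C q \<and> Dom C p = Cod C y \<and> x \<cdot>\<^bsub>C\<^esub> q = p \<cdot>\<^bsub>C\<^esub> y \<longrightarrow> x \<in> T)"

text \<open>The family is nonempty (\<open>S\<close> itself belongs to it), and its intersection belongs to it.\<close>

definition S_circ :: "('o, 'm) cat \<Rightarrow> 'm set \<Rightarrow> 'm set \<Rightarrow> 'm set" where
  "S_circ C P S = \<Inter>{T. S_star C S \<subseteq> T \<and> T \<subseteq> S \<and> pullback_stable C T \<and> factor_stable C P S T}"

inductive_set zeq :: "('o, 'm) cat \<Rightarrow> 'm set \<Rightarrow> 'm set \<Rightarrow> (('m \<times> 'm) \<times> ('m \<times> 'm)) set"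
  for C :: "('o, 'm) cat" and P S :: "'m set" where
  step: "\<lbrakk>a \<in> spans C S; b \<in> spans C S; x \<in> S_circ C P S; span_mor C x a b\<rbrakk>
    \<Longrightarrow> (a, b) \<in> zeq C P S"
| refl: "a \<in> spans C S \<Longrightarrow> (a, a) \<in> zeq C P S"
| sym: "(a, b) \<in> zeq C P S \<Longrightarrow> (b, a) \<in> zeq C P S"
| trans: "\<lbrakk>(a, b) \<in> zeq C P S; (b, c) \<in> zeq C P S\<rbrakk> \<Longrightarrow> (a, c) \<in> zeq C P S"

definition zeq_Span ::
  "('o, 'm) cat \<Rightarrow> 'm set \<Rightarrow> 'm set \<Rightarrow> (('m \<times> 'm) set \<times> ('m \<times> 'm) set) set" where
  "zeq_Span C P S = {(a, b). a \<in> Arr (Span C S) \<and> b \<in> Arr (Span C S) \<and>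
     (\<exists>x \<in> a. \<exists>y \<in> b. (x, y) \<in> zeq C P S)}"

text \<open>For a congruence \<open>R\<close> on the arrows of \<open>K\<close>; the union is then one of equal classes.\<close>

definition quotient_cat :: "('o, 'm) cat \<Rightarrow> ('m \<times> 'm) set \<Rightarrow> ('o, 'm set) cat" where
  "quotient_cat K R = \<lparr>
     Obj = Obj K,
     Arr = Arr K // R,
     Dom = (\<lambda>a. the_elem (Dom K ` a)),
     Cod = (\<lambda>a. the_elem (Cod K ` a)),
     Id = (\<lambda>A. R `` {Id K A}),
     Comp = (\<lambda>b a. \<Union>x \<in> a. \<Union>y \<in> b. R `` {y \<cdot>\<^bsub>K\<^esub> x}) \<rparr>"

definition RaPar ::
  "('o, 'm) cat \<Rightarrow> 'm set \<Rightarrow> 'm set \<Rightarrow> ('o, ('m \<times> 'm) set set) cat" where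
  "RaPar C P S = quotient_cat (Span C S) (zeq_Span C P S)"

definition zclass ::
  "('o, 'm) cat \<Rightarrow> 'm set \<Rightarrow> 'm set \<Rightarrow> 'm \<Rightarrow> 'm \<Rightarrow> ('m \<times> 'm) set set" where
  "zclass C P S s f = zeq_Span C P S `` {span_iso C S `` {(s, f)}}"

locale restriction_category = category K
  for K :: "('o, 'm) cat" (structure) +
  fixes rs :: "'m \<Rightarrow> 'm"
  assumes rs_Hom: "f \<in> Hom K A B \<Longrightarrow> rs f \<in> Hom K A A"
    and R1: "f \<in> Arr K \<Longrightarrow> f \<cdot> rs f = f"
    and R2: "\<lbrakk>f \<in> Arr K; g \<in> Arr K; Dom K f = Dom K g\<rbrakk> \<Longrightarrow> rs f \<cdot> rs g = rs g \<cdot> rs f"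
    and R3: "\<lbrakk>f \<in> Arr K; g \<in> Arr K; Dom K f = Dom K g\<rbrakk> \<Longrightarrow> rs (g \<cdot> rs f) = rs g \<cdot> rs f"
    and R4: "\<lbrakk>f \<in> Arr K; g \<in> Arr K; Cod K f = Dom K g\<rbrakk> \<Longrightarrow> rs g \<cdot> f = f \<cdot> rs (g \<cdot> f)"

locale split_restriction_category = restriction_category +
  assumes split: "\<lbrakk>e \<in> Arr K; rs e = e\<rbrakk>
    \<Longrightarrow> \<exists>X. \<exists>m \<in> Hom K X (Dom K e). \<exists>r \<in> Hom K (Dom K e) X. X \<in> Obj K \<and> e = m \<cdot> r \<and> r \<cdot> m = Id K X"

locale range_category = restriction_category +
  fixes rg :: "'m \<Rightarrow> 'm"
  assumes rg_Hom: "f \<in> Hom K A B \<Longrightarrow> rg f \<in> Hom K B B"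
    and RR1: "f \<in> Arr K \<Longrightarrow> rs (rg f) = rg f"
    and RR2: "f \<in> Arr K \<Longrightarrow> rg f \<cdot> f = f"
    and RR3: "\<lbrakk>f \<in> Arr K; g \<in> Arr K; Cod K f = Dom K g\<rbrakk> \<Longrightarrow> rg (rs g \<cdot> f) = rs g \<cdot> rg f"
    and RR4: "\<lbrakk>f \<in> Arr K; g \<in> Arr K; Cod K f = Dom K g\<rbrakk> \<Longrightarrow> rg (g \<cdot> rg f) = rg (g \<cdot> f)"

locale split_range_category = range_category + split_restriction_category

end

theory Submission
  imports Defs
begin

text \<open>Suppose \<open>f = s \<cdot> k\<close> with \<open>s \<in> S\<close>.  The section \<open>w\<close> of the pullback \<open>s'\<close> of \<open>s\<close> along \<open>f\<close> that \<open>k\<close>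
  induces is the conjugate of \<open>s\<close> viewed as a cospan morphism from \<open>\<langle>k, 1\<rangle>\<close> to \<open>\<langle>f, s\<rangle>\<close>, so it
  lies in \<open>S_star\<close>.  Sections of this kind are exactly what is needed to identify the two sides of R1
  and R4 (the lift of a diagonal), of RR2 (\<open>k = pf f\<close>), and to split \<open>[s, s]\<close> as \<open>[1, s] \<cdot> [s, 1]\<close>;
  R2 and R3 hold already for spans.  If \<open>x \<in> S_circ\<close> is a morphism from \<open>(s, f)\<close> to \<open>(t, g)\<close>, the
  diagonal \<open>d\<close> with \<open>d \<cdot> pf f = pf g \<cdot> x\<close> and \<open>sf g \<cdot> d = sf f\<close> is in \<open>S_circ\<close> by the factor stability of
  that class, so ranges are well defined and do not depend on the factorization.  Since \<open>P\<close> is stable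
  under pullback along \<open>S\<close>, pulling back \<open>f = sf f \<cdot> pf f\<close> along an \<open>S\<close>-morphism factorizes the
  pullback, which gives RR3 and RR4.\<close>

section \<open>Categories and pullbacks\<close>

lemma the_elem_const: "A \<noteq> {} \<Longrightarrow> (\<And>x. x \<in> A \<Longrightarrow> f x = c) \<Longrightarrow> the_elem (f ` A) = c"
  by (metis image_cong image_constant_conv the_elem_eq)

context category
begin

lemma Hom_iff: "f \<in> Hom C A B \<longleftrightarrow> f \<in> Arr C \<and> Dom C f = A \<and> Cod C f = B"
  by (simp add: Hom_def)

lemma comp_simps [simp]:
  assumes "f \<in> Arr C" "g \<in> Arr C" "Dom C g = Cod C f"
  shows "g \<cdot> f \<in> Arr C" "Dom C (g \<cdot> f) = Dom C f" "Cod C (g \<cdot> f) = Cod C g"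
  using Comp_Hom[of f "Dom C f" "Cod C f" g "Cod C g"] assms by (auto simp: Hom_iff)

lemma comp_assoc [simp]:
  assumes "f \<in> Arr C" "g \<in> Arr C" "h \<in> Arr C" "Dom C g = Cod C f" "Dom C h = Cod C g"
  shows "(h \<cdot> g) \<cdot> f = h \<cdot> (g \<cdot> f)"
  using Comp_assoc[of f "Dom C f" "Cod C f" g "Cod C g" h "Cod C h"] assms by (auto simp: Hom_iff)

lemma id_simps [simp]:
  assumes "A \<in> Obj C"
  shows "Id C A \<in> Arr C" "Dom C (Id C A) = A" "Cod C (Id C A) = A"
  using Id_Hom[OF assms] by (auto simp: Hom_iff)

lemma comp_id [simp]:
  assumes "f \<in> Arr C"
  shows "Dom C f = A \<Longrightarrow> f \<cdot> Id C A = f" "Cod C f = A \<Longrightarrow> Id C A \<cdot> f = f"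
  using Comp_Id_right[of f "Dom C f" "Cod C f"] Comp_Id_left[of f "Dom C f" "Cod C f"] assms
  by (auto simp: Hom_iff)

lemmas Dom_Cod_Obj [simp] = Dom_closed Cod_closed

text \<open>Since \<open>comp_assoc\<close> is a simp rule, composites are normalized to right
  bracketing, and an equation between two-fold composites no longer matches inside a longer one.
  This lemma and the next precompose such an equation while keeping that normal form.\<close>

lemma comp_eq_extend:
  assumes "f \<cdot> g = h \<cdot> k" "f \<in> Arr C" "g \<in> Arr C" "h \<in> Arr C" "k \<in> Arr C" "x \<in> Arr C"
    "Dom C f = Cod C g" "Dom C h = Cod C k" "Dom C g = Cod C x" "Dom C k = Cod C x"
  shows "f \<cdot> (g \<cdot> x) = h \<cdot> (k \<cdot> x)"
  using comp_assoc[of x g f] comp_assoc[of x k h] assms by simp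

lemma comp_eq_extend1:
  assumes "f \<cdot> g = h" "f \<in> Arr C" "g \<in> Arr C" "x \<in> Arr C"
    "Dom C f = Cod C g" "Dom C g = Cod C x"
  shows "f \<cdot> (g \<cdot> x) = h \<cdot> x"
  using comp_assoc[of x g f] assms by simp

section \<open>Calculus of pullback squares\<close>

lemma pullbackD:
  assumes "is_pullback C f t t' f'"
  shows "f \<in> Arr C" "t \<in> Arr C" "t' \<in> Arr C" "f' \<in> Arr C"
    "Cod C f = Cod C t" "Dom C f' = Dom C t'" "Cod C t' = Dom C f" "Cod C f' = Dom C t"
    "f \<cdot> t' = t \<cdot> f'"
  using assms by (auto simp: is_pullback_def Hom_iff)

lemma pullback_lift:
  assumes "is_pullback C f t t' f'" "u \<in> Arr C" "v \<in> Arr C" "Dom C u = Dom C v"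
    "Cod C u = Dom C f" "Cod C v = Dom C t" "f \<cdot> u = t \<cdot> v"
  obtains w where "w \<in> Arr C" "Dom C w = Dom C v" "Cod C w = Dom C t'" "t' \<cdot> w = u" "f' \<cdot> w = v"
proof -
  have "\<exists>!w. w \<in> Hom C (Dom C v) (Dom C t') \<and> t' \<cdot> w = u \<and> f' \<cdot> w = v"
    using assms unfolding is_pullback_def by (simp add: Hom_iff)
  then show thesis using that by (auto simp: Hom_iff)
qed

lemma pullback_unique:
  assumes pb: "is_pullback C f t t' f'" and w: "w \<in> Arr C" "Cod C w = Dom C t'"
    and w': "w' \<in> Arr C" "Cod C w' = Dom C t'"
    and eq: "Dom C w = Dom C w'" "t' \<cdot> w = t' \<cdot> w'" "f' \<cdot> w = f' \<cdot> w'"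
  shows "w = w'"
proof -
  note [simp] = pullbackD[OF pb] w w'
  have "f \<cdot> (t' \<cdot> w) = t \<cdot> (f' \<cdot> w)"
    by (rule comp_eq_extend) simp_all
  then have "\<exists>!x. x \<in> Hom C (Dom C w) (Dom C t') \<and> t' \<cdot> x = t' \<cdot> w \<and> f' \<cdot> x = f' \<cdot> w"
    using pb unfolding is_pullback_def by (simp add: Hom_iff)
  moreover have "w \<in> Hom C (Dom C w) (Dom C t')" "w' \<in> Hom C (Dom C w) (Dom C t')"
    using eq(1) by (simp_all add: Hom_iff)
  ultimately show ?thesis using eq by metis
qed

text \<open>Unique existence is split into existence of lifts and joint cancellability of the two
  projections. Typing is stated by \<open>Dom\<close> and \<open>Cod\<close> equations instead of
  \<open>Hom\<close>, so that the simplifier can discharge it.\<close>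

lemma pullbackI:
  assumes "f \<in> Arr C" "t \<in> Arr C" "t' \<in> Arr C" "f' \<in> Arr C"
    "Cod C f = Cod C t" "Dom C f' = Dom C t'" "Cod C t' = Dom C f" "Cod C f' = Dom C t"
    "f \<cdot> t' = t \<cdot> f'"
    and lift: "\<And>u v. \<lbrakk>u \<in> Arr C; v \<in> Arr C; Dom C u = Dom C v; Cod C u = Dom C f;
      Cod C v = Dom C t; f \<cdot> u = t \<cdot> v\<rbrakk>
      \<Longrightarrow> \<exists>w. w \<in> Arr C \<and> Dom C w = Dom C v \<and> Cod C w = Dom C t' \<and> t' \<cdot> w = u \<and> f' \<cdot> w = v"
    and unique: "\<And>w w'. \<lbrakk>w \<in> Arr C; w' \<in> Arr C; Dom C w = Dom C w'; Cod C w = Dom C t';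
      Cod C w' = Dom C t'; t' \<cdot> w = t' \<cdot> w'; f' \<cdot> w = f' \<cdot> w'\<rbrakk> \<Longrightarrow> w = w'"
  shows "is_pullback C f t t' f'"
proof -
  have "\<exists>!w. w \<in> Hom C X (Dom C t') \<and> t' \<cdot> w = u \<and> f' \<cdot> w = v"
    if "u \<in> Hom C X (Dom C f)" "v \<in> Hom C X (Dom C t)" "f \<cdot> u = t \<cdot> v" for X u v
  proof (rule ex_ex1I)
    show "\<exists>w. w \<in> Hom C X (Dom C t') \<and> t' \<cdot> w = u \<and> f' \<cdot> w = v"
      using that lift[of u v] by (simp add: Hom_iff)
  qed (rule unique; simp add: Hom_iff)
  moreover have "t' \<in> Hom C (Dom C t') (Dom C f)" "f' \<in> Hom C (Dom C t') (Dom C t)"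
    using assms(3,4,6-8) by (simp_all add: Hom_iff)
  ultimately show ?thesis
    using assms(1,2,5,9) unfolding is_pullback_def by blast
qed

lemma pullback_swap:
  assumes "is_pullback C f t t' f'"
  shows "is_pullback C t f f' t'"
proof (rule pullbackI)
  fix u v
  assume "u \<in> Arr C" "v \<in> Arr C" "Dom C u = Dom C v" "Cod C u = Dom C t"
    "Cod C v = Dom C f" "t \<cdot> u = f \<cdot> v"
  then obtain w where "w \<in> Arr C" "Dom C w = Dom C u" "Cod C w = Dom C t'" "t' \<cdot> w = v" "f' \<cdot> w = u"
    using pullback_lift[OF assms, of v u] by metis
  then show "\<exists>w. w \<in> Arr C \<and> Dom C w = Dom C v \<and> Cod C w = Dom C f' \<and> f' \<cdot> w = u \<and> t' \<cdot> w = v"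
    using \<open>Dom C u = Dom C v\<close> pullbackD(6)[OF assms] by (intro exI[of _ w]) simp
next
  fix w w'
  assume "w \<in> Arr C" "w' \<in> Arr C" "Dom C w = Dom C w'" "Cod C w = Dom C f'"
    "Cod C w' = Dom C f'" "f' \<cdot> w = f' \<cdot> w'" "t' \<cdot> w = t' \<cdot> w'"
  then show "w = w'"
    using pullbackD(6)[OF assms] by - (rule pullback_unique[OF assms], simp_all)
qed (use pullbackD[OF assms] in simp_all)

text \<open>A cone over the outer rectangle is lifted first through the square on \<open>f\<close>,
  then through the square on \<open>h\<close>. Uniqueness runs the same way: the first square
  identifies the composites with \<open>h'\<close>, the second the arrows themselves.\<close>

lemma pullback_paste:
  assumes pb: "is_pullback C f t t' f'" and pb': "is_pullback C h t' t'' h'"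
  shows "is_pullback C (f \<cdot> h) t t'' (f' \<cdot> h')"
proof -
  note [simp] = pullbackD[OF pb] pullbackD(1,3,4,6-8)[OF pb'] pullbackD(5)[OF pb', symmetric]
  note sq = pullbackD(9)[OF pb] and sq' = pullbackD(9)[OF pb']
  have [simp]: "Cod C h = Dom C f"
    using pullbackD(5)[OF pb'] by simp
  show ?thesis
  proof (rule pullbackI)
    show "(f \<cdot> h) \<cdot> t'' = t \<cdot> (f' \<cdot> h')"
      using comp_eq_extend[OF sq, of h'] sq' by simp
  next
    fix u v
    assume [simp]: "u \<in> Arr C" "v \<in> Arr C" "Dom C u = Dom C v" "Cod C v = Dom C t"
      and "Cod C u = Dom C (f \<cdot> h)" and eq: "(f \<cdot> h) \<cdot> u = t \<cdot> v"
    then have [simp]: "Cod C u = Dom C h" by simp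
    obtain w where w [simp]: "w \<in> Arr C" "Dom C w = Dom C v" "Cod C w = Dom C t'"
      and w': "t' \<cdot> w = h \<cdot> u" "f' \<cdot> w = v"
      by (rule pullback_lift[OF pb, of "h \<cdot> u" v]) (use eq in simp_all)
    obtain z where z [simp]: "z \<in> Arr C" "Dom C z = Dom C w" "Cod C z = Dom C t''"
      and z': "t'' \<cdot> z = u" "h' \<cdot> z = w"
      by (rule pullback_lift[OF pb', of u w]) (use w' in simp_all)
    show "\<exists>w. w \<in> Arr C \<and> Dom C w = Dom C v \<and> Cod C w = Dom C t'' \<and> t'' \<cdot> w = u \<and> (f' \<cdot> h') \<cdot> w = v"
      by (rule exI[of _ z]) (simp add: z' w')
  next
    fix w w'
    assume [simp]: "w \<in> Arr C" "w' \<in> Arr C" "Dom C w = Dom C w'" "Cod C w = Dom C t''"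
      "Cod C w' = Dom C t''" and eq: "t'' \<cdot> w = t'' \<cdot> w'" "(f' \<cdot> h') \<cdot> w = (f' \<cdot> h') \<cdot> w'"
    have "t' \<cdot> (h' \<cdot> w) = t' \<cdot> (h' \<cdot> w')"
      using comp_eq_extend[OF sq', of w] comp_eq_extend[OF sq', of w'] eq(1) by simp
    then have "h' \<cdot> w = h' \<cdot> w'"
      by - (rule pullback_unique[OF pb], use eq(2) in simp_all)
    then show "w = w'"
      by - (rule pullback_unique[OF pb'], use eq(1) in simp_all)
  qed simp_all
qed

text \<open>Converse of pasting. The arrow \<open>h'\<close> is induced by the inner square; a cone
  over the new square becomes a cone over the outer rectangle after composition with
  \<open>f'\<close>, and that rectangle provides the lift.\<close>

lemma pullback_cancel:
  assumes pb: "is_pullback C f t t' f'" and pb': "is_pullback C (f \<cdot> h) t t'' k"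
    and h [simp]: "h \<in> Arr C" "Cod C h = Dom C f"
  obtains h' where "is_pullback C h t' t'' h'" "f' \<cdot> h' = k"
proof -
  note [simp] = pullbackD[OF pb] pullbackD(1,3,4,6,8)[OF pb']
  have [simp]: "Cod C t'' = Dom C h"
    using pullbackD(7)[OF pb'] by simp
  have eq: "f \<cdot> (h \<cdot> t'') = t \<cdot> k"
    using pullbackD(9)[OF pb'] by simp
  obtain h' where h' [simp]: "h' \<in> Arr C" "Dom C h' = Dom C k" "Cod C h' = Dom C t'"
    and sq: "t' \<cdot> h' = h \<cdot> t''" and k: "f' \<cdot> h' = k"
    by (rule pullback_lift[OF pb, of "h \<cdot> t''" k]) (use eq in simp_all)
  have "is_pullback C h t' t'' h'"
  proof (rule pullbackI)
    fix u v
    assume [simp]: "u \<in> Arr C" "v \<in> Arr C" "Dom C u = Dom C v" "Cod C u = Dom C h"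
      "Cod C v = Dom C t'" and uv: "h \<cdot> u = t' \<cdot> v"
    have "f \<cdot> (h \<cdot> u) = t \<cdot> (f' \<cdot> v)"
      using comp_eq_extend[OF pullbackD(9)[OF pb], of v] uv by simp
    then obtain w where w [simp]: "w \<in> Arr C" "Dom C w = Dom C v" "Cod C w = Dom C t''"
      and w': "t'' \<cdot> w = u" "k \<cdot> w = f' \<cdot> v"
      by - (rule pullback_lift[OF pb', of u "f' \<cdot> v"], simp_all)
    \<comment> \<open>The lift came from the outer rectangle and is only known there after
      composition with \<open>f'\<close>; both projections of the inner square are needed to recover
      \<open>v\<close>.\<close>
    have "h' \<cdot> w = v"
    proof (rule pullback_unique[OF pb])
      have "t' \<cdot> (h' \<cdot> w) = h \<cdot> (t'' \<cdot> w)"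
        by (rule comp_eq_extend[OF sq]) simp_all
      then show "t' \<cdot> (h' \<cdot> w) = t' \<cdot> v"
        unfolding w' uv .
      show "f' \<cdot> (h' \<cdot> w) = f' \<cdot> v"
        using comp_eq_extend1[OF k, of w] w' by simp
    qed simp_all
    with w' show "\<exists>w. w \<in> Arr C \<and> Dom C w = Dom C v \<and> Cod C w = Dom C t'' \<and> t'' \<cdot> w = u \<and> h' \<cdot> w = v"
      by (intro exI[of _ w]) simp
  next
    fix w w'
    assume [simp]: "w \<in> Arr C" "w' \<in> Arr C" "Dom C w = Dom C w'" "Cod C w = Dom C t''"
      "Cod C w' = Dom C t''" and eq: "t'' \<cdot> w = t'' \<cdot> w'" "h' \<cdot> w = h' \<cdot> w'"
    have "k \<cdot> w = f' \<cdot> (h' \<cdot> w)" "k \<cdot> w' = f' \<cdot> (h' \<cdot> w')"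
      by (rule comp_eq_extend1[OF k, symmetric]; simp)+
    with eq show "w = w'"
      by - (rule pullback_unique[OF pb'], simp_all)
  qed (simp_all add: sq)
  then show thesis using k by (rule that)
qed

lemma pullback_id:
  assumes f [simp]: "f \<in> Arr C"
  shows "is_pullback C f (Id C (Cod C f)) (Id C (Dom C f)) f"
proof (rule pullbackI)
  fix u v
  assume "u \<in> Arr C" "v \<in> Arr C" "Dom C u = Dom C v" "Cod C u = Dom C f"
    "Cod C v = Dom C (Id C (Cod C f))" "f \<cdot> u = Id C (Cod C f) \<cdot> v"
  then show "\<exists>w. w \<in> Arr C \<and> Dom C w = Dom C v \<and> Cod C w = Dom C (Id C (Dom C f)) \<and>
      Id C (Dom C f) \<cdot> w = u \<and> f \<cdot> w = v"
    by (intro exI[of _ u]) simp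
qed simp_all

section \<open>Isomorphisms and their pullbacks\<close>

lemma is_isoE:
  assumes "is_iso C f"
  obtains g where "f \<in> Arr C" "g \<in> Arr C" "Dom C g = Cod C f" "Cod C g = Dom C f"
    "g \<cdot> f = Id C (Dom C f)" "f \<cdot> g = Id C (Cod C f)"
proof -
  from assms obtain g where "f \<in> Arr C" "g \<in> Hom C (Cod C f) (Dom C f)"
    "g \<cdot> f = Id C (Dom C f)" "f \<cdot> g = Id C (Cod C f)"
    unfolding is_iso_def by auto
  then show thesis
    by (intro that) (simp_all add: Hom_iff)
qed

lemma is_isoI:
  assumes "f \<in> Arr C" "g \<in> Arr C" "Dom C g = Cod C f" "Cod C g = Dom C f"
    "g \<cdot> f = Id C (Dom C f)" "f \<cdot> g = Id C (Cod C f)"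
  shows "is_iso C f"
  unfolding is_iso_def using assms by (intro conjI bexI[of _ g]) (simp_all add: Hom_iff)

lemma is_iso_id: "A \<in> Obj C \<Longrightarrow> is_iso C (Id C A)"
  by (rule is_isoI[of _ "Id C A"]) simp_all

lemma is_iso_comp:
  assumes "is_iso C f" "is_iso C g" "Dom C g = Cod C f"
  shows "is_iso C (g \<cdot> f)"
proof -
  obtain f' where f [simp]: "f \<in> Arr C" "f' \<in> Arr C" "Dom C f' = Cod C f" "Cod C f' = Dom C f"
    and f': "f' \<cdot> f = Id C (Dom C f)" "f \<cdot> f' = Id C (Cod C f)"
    using assms(1) by (rule is_isoE)
  obtain g' where g [simp]: "g \<in> Arr C" "g' \<in> Arr C" "Dom C g' = Cod C g" "Cod C g' = Dom C g"
    and g': "g' \<cdot> g = Id C (Dom C g)" "g \<cdot> g' = Id C (Cod C g)"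
    using assms(2) by (rule is_isoE)
  note [simp] = assms(3)
  show ?thesis
  proof (rule is_isoI[of _ "f' \<cdot> g'"])
    show "(f' \<cdot> g') \<cdot> g \<cdot> f = Id C (Dom C (g \<cdot> f))"
      using comp_eq_extend1[OF g'(1), of f] f' by simp
    show "(g \<cdot> f) \<cdot> f' \<cdot> g' = Id C (Cod C (g \<cdot> f))"
      using comp_eq_extend1[OF f'(2), of g'] g' by simp
  qed simp_all
qed

text \<open>If \<open>i\<close> inverts \<open>t\<close>, the cone formed by an identity and
  \<open>i \<cdot> f\<close> lifts to an inverse of \<open>t'\<close>. In this form the isomorphisms
  can serve as the class \<open>T\<close> in the congruence lemmas for
  \<open>span_rel\<close>.\<close>

lemma is_iso_pullback_stable: "pullback_stable C {i. is_iso C i}"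
  unfolding pullback_stable_def
proof (intro allI impI, clarsimp)
  fix f t t' f'
  assume pb: "is_pullback C f t t' f'" and "is_iso C t"
  then obtain i where [simp]: "i \<in> Arr C" "Dom C i = Cod C t" "Cod C i = Dom C t"
    and i: "i \<cdot> t = Id C (Dom C t)" "t \<cdot> i = Id C (Cod C t)"
    by (auto elim: is_isoE)
  note [simp] = pullbackD[OF pb]
  have "f \<cdot> Id C (Dom C f) = t \<cdot> (i \<cdot> f)"
    using comp_eq_extend1[OF i(2), of f] by simp
  then obtain w where w [simp]: "w \<in> Arr C" "Dom C w = Dom C f" "Cod C w = Dom C t'"
    and w': "t' \<cdot> w = Id C (Dom C f)" "f' \<cdot> w = i \<cdot> f"
    by - (rule pullback_lift[OF pb, of "Id C (Dom C f)" "i \<cdot> f"], simp_all)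
  have "w \<cdot> t' = Id C (Dom C t')"
  proof (rule pullback_unique[OF pb])
    show "t' \<cdot> w \<cdot> t' = t' \<cdot> Id C (Dom C t')"
      using comp_eq_extend1[OF w'(1), of t'] by simp
    have "f' \<cdot> w \<cdot> t' = (i \<cdot> f) \<cdot> t'"
      using comp_eq_extend1[OF w'(2), of t'] by simp
    also have "\<dots> = i \<cdot> (t \<cdot> f')" by simp
    also have "\<dots> = f'" using comp_eq_extend1[OF i(1), of f'] by simp
    finally show "f' \<cdot> w \<cdot> t' = f' \<cdot> Id C (Dom C t')" by simp
  qed simp_all
  then show "is_iso C t'"
    using w' by (intro is_isoI[of _ w]) simp_all
qed

text \<open>Exhibits every isomorphism as a pullback of an identity, so a pullback-stable class
  containing the identities contains all isomorphisms.\<close>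

lemma pullback_iso:
  assumes "is_iso C i"
  shows "is_pullback C (Id C (Cod C i)) (Id C (Cod C i)) i i"
proof -
  obtain j where [simp]: "i \<in> Arr C" "j \<in> Arr C" "Dom C j = Cod C i" "Cod C j = Dom C i"
    and j: "j \<cdot> i = Id C (Dom C i)" "i \<cdot> j = Id C (Cod C i)"
    using assms by (rule is_isoE)
  show ?thesis
  proof (rule pullbackI)
    fix u v
    assume [simp]: "u \<in> Arr C" "v \<in> Arr C" "Dom C u = Dom C v"
      and u: "Cod C u = Dom C (Id C (Cod C i))" "Cod C v = Dom C (Id C (Cod C i))"
      "Id C (Cod C i) \<cdot> u = Id C (Cod C i) \<cdot> v"
    then have uv: "u = v" and [simp]: "Cod C v = Cod C i" by simp_all
    have "i \<cdot> (j \<cdot> v) = Id C (Cod C i) \<cdot> v"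
      by (rule comp_eq_extend1[OF j(2)]) simp_all
    then show "\<exists>w. w \<in> Arr C \<and> Dom C w = Dom C v \<and> Cod C w = Dom C i \<and> i \<cdot> w = u \<and> i \<cdot> w = v"
      unfolding uv by (intro exI[of _ "j \<cdot> v"]) simp
  next
    have *: "j \<cdot> (i \<cdot> w) = w" if "w \<in> Arr C" "Cod C w = Dom C i" for w
      using comp_eq_extend1[OF j(1), of w] that by simp
    fix w w'
    assume "w \<in> Arr C" "w' \<in> Arr C" "Cod C w = Dom C i" "Cod C w' = Dom C i" "i \<cdot> w = i \<cdot> w'"
    then show "w = w'"
      using *[of w] *[of w'] by metis
  qed simp_all
qed

end

section \<open>Spans\<close>

text \<open>A composite of representatives depends on a pullback square. Collecting the results of
  all squares avoids a choice; uniqueness up to equivalence is proved afterwards.\<close>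

definition span_comps :: "('o, 'm) cat \<Rightarrow> 'm \<times> 'm \<Rightarrow> 'm \<times> 'm \<Rightarrow> ('m \<times> 'm) set" where
  "span_comps C b a =
     {(fst a \<cdot>\<^bsub>C\<^esub> t', snd b \<cdot>\<^bsub>C\<^esub> f') | t' f'. is_pullback C (snd a) (fst b) t' f'}"

text \<open>The class \<open>T\<close> is a parameter so that one argument covers both quotients:
  isomorphisms give \<open>span_iso\<close>, and \<open>S_circ\<close> gives the generating steps of
  \<open>zeq\<close>.\<close>

definition span_rel :: "('o, 'm) cat \<Rightarrow> 'm set \<Rightarrow> 'm set \<Rightarrow> (('m \<times> 'm) \<times> ('m \<times> 'm)) set" where
  "span_rel C S T = {(a, b). a \<in> spans C S \<and> b \<in> spans C S \<and> (\<exists>x \<in> T. span_mor C x a b)}"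

lemma span_iso_eq: "span_iso C S = span_rel C S {i. is_iso C i}"
  unfolding span_iso_def span_rel_def by auto

locale stable_factorization = category C for C :: "('o, 'm) cat" (structure) +
  fixes P S :: "'m set" and sf pf :: "'m \<Rightarrow> 'm"
  assumes has_pb: "has_pullbacks_of C S"
    and S_stable: "pullback_stable C S"
    and ofs: "orthogonal_factorization_system C P S"
    and rel_stable: "relatively_stable C P S"
    and fact: "f \<in> Arr C \<Longrightarrow> is_factorization C P S f (sf f) (pf f)"
begin

section \<open>Consequences of the orthogonal factorization system\<close>

lemma S_arr [simp]: "s \<in> S \<Longrightarrow> s \<in> Arr C"
  and P_arr [simp]: "p \<in> P \<Longrightarrow> p \<in> Arr C"
  and iso_S: "is_iso C i \<Longrightarrow> i \<in> S"
  and S_comp [simp]: "\<lbrakk>s \<in> S; t \<in> S; Dom C t = Cod C s\<rbrakk> \<Longrightarrow> t \<cdot> s \<in> S"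
  and P_comp [simp]: "\<lbrakk>p \<in> P; q \<in> P; Dom C q = Cod C p\<rbrakk> \<Longrightarrow> q \<cdot> p \<in> P"
  using ofs unfolding orthogonal_factorization_system_def by blast+

lemma id_S [simp]: "A \<in> Obj C \<Longrightarrow> Id C A \<in> S"
  by (rule iso_S[OF is_iso_id])

lemma diagonal_ex1:
  assumes "p \<in> P" "s \<in> S" "u \<in> Arr C" "v \<in> Arr C" "Dom C u = Dom C p" "Cod C u = Dom C s"
    "Dom C v = Cod C p" "Cod C v = Cod C s" "s \<cdot> u = v \<cdot> p"
  shows "\<exists>!d. d \<in> Hom C (Cod C p) (Dom C s) \<and> d \<cdot> p = u \<and> s \<cdot> d = v"
proof -
  have "\<forall>p \<in> P. \<forall>s \<in> S. \<forall>u \<in> Hom C (Dom C p) (Dom C s). \<forall>v \<in> Hom C (Cod C p) (Cod C s).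
        s \<cdot> u = v \<cdot> p \<longrightarrow> (\<exists>!d. d \<in> Hom C (Cod C p) (Dom C s) \<and> d \<cdot> p = u \<and> s \<cdot> d = v)"
    using ofs unfolding orthogonal_factorization_system_def by blast
  moreover have "u \<in> Hom C (Dom C p) (Dom C s)" "v \<in> Hom C (Cod C p) (Cod C s)"
    using assms by (simp_all add: Hom_iff)
  ultimately show ?thesis using assms(1,2,9) by blast
qed

lemma diagonal:
  assumes "p \<in> P" "s \<in> S" "u \<in> Arr C" "v \<in> Arr C" "Dom C u = Dom C p" "Cod C u = Dom C s"
    "Dom C v = Cod C p" "Cod C v = Cod C s" "s \<cdot> u = v \<cdot> p"
  obtains d where "d \<in> Arr C" "Dom C d = Cod C p" "Cod C d = Dom C s" "d \<cdot> p = u" "s \<cdot> d = v"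
proof -
  obtain d where "d \<in> Hom C (Cod C p) (Dom C s)" "d \<cdot> p = u" "s \<cdot> d = v"
    using diagonal_ex1[OF assms] by blast
  then show thesis by (intro that[of d]) (simp_all add: Hom_iff)
qed

lemma diagonal_unique:
  assumes "p \<in> P" "s \<in> S" "d \<in> Arr C" "Dom C d = Cod C p" "Cod C d = Dom C s"
    "e \<in> Arr C" "Dom C e = Cod C p" "Cod C e = Dom C s" "d \<cdot> p = e \<cdot> p" "s \<cdot> d = s \<cdot> e"
  shows "d = e"
proof -
  have "\<exists>!x. x \<in> Hom C (Cod C p) (Dom C s) \<and> x \<cdot> p = d \<cdot> p \<and> s \<cdot> x = s \<cdot> d"
    by (rule diagonal_ex1) (use assms(1-5) in simp_all)
  moreover have "d \<in> Hom C (Cod C p) (Dom C s)" "e \<in> Hom C (Cod C p) (Dom C s)"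
    using assms by (simp_all add: Hom_iff)
  ultimately show ?thesis using assms(9,10) by metis
qed

lemma factE:
  assumes "f \<in> Arr C"
  shows "sf f \<in> S" "pf f \<in> P" "Cod C (pf f) = Dom C (sf f)" "sf f \<cdot> pf f = f"
    "Dom C (pf f) = Dom C f" "Cod C (sf f) = Cod C f"
proof -
  show *: "sf f \<in> S" "pf f \<in> P" "Cod C (pf f) = Dom C (sf f)" "sf f \<cdot> pf f = f"
    using fact[OF assms] unfolding is_factorization_def by auto
  show "Dom C (pf f) = Dom C f" "Cod C (sf f) = Cod C f"
    using comp_simps(2,3)[of "pf f" "sf f"] * by simp_all
qed

text \<open>For \<open>x = s \<cdot> p\<close> the lifting problem \<open>t \<cdot> 1 = (t \<cdot> s) \<cdot> p\<close> yields a left inverse of \<open>p\<close>,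
  which is two-sided by uniqueness of diagonals; so \<open>p\<close> is invertible.\<close>

lemma S_cancel:
  assumes x [simp]: "x \<in> Arr C" and t [simp]: "t \<in> S" and tx: "t \<cdot> x \<in> S"
    and dom [simp]: "Dom C t = Cod C x"
  shows "x \<in> S"
proof -
  let ?s = "sf x" and ?p = "pf x"
  note [simp] = factE(1-3,5,6)[OF x]
  have fx: "?s \<cdot> ?p = x" by (rule factE(4)[OF x])
  have sq: "(t \<cdot> x) \<cdot> Id C (Dom C x) = (t \<cdot> ?s) \<cdot> ?p"
    using fx by simp
  obtain d where [simp]: "d \<in> Arr C" "Dom C d = Cod C ?p" "Cod C d = Dom C x"
    and d: "d \<cdot> ?p = Id C (Dom C x)" "(t \<cdot> x) \<cdot> d = t \<cdot> ?s"
    by (rule diagonal[OF factE(2)[OF x] tx _ _ _ _ _ _ sq]) simp_all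
  have pdp: "?p \<cdot> (d \<cdot> ?p) = ?p"
    unfolding d by simp
  have "?s \<cdot> (?p \<cdot> d) = x \<cdot> d"
    by (rule comp_eq_extend1[OF fx]) simp_all
  then have "t \<cdot> (?s \<cdot> (?p \<cdot> d)) = t \<cdot> ?s"
    using d(2) by simp
  then have "?p \<cdot> d = Id C (Dom C ?s)"
    by - (rule diagonal_unique[of ?p "t \<cdot> ?s"], simp_all add: pdp)
  then have "is_iso C ?p"
    using d by (intro is_isoI[of _ d]) simp_all
  then have "?s \<cdot> ?p \<in> S"
    using iso_S by simp
  then show ?thesis by (simp add: fx)
qed

section \<open>Pullback stability and the classes \<open>S_star\<close> and
  \<open>S_circ\<close>\<close>

lemma pullback_exists:
  assumes "f \<in> Arr C" "t \<in> S" "Cod C f = Cod C t"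
  obtains t' f' where "is_pullback C f t t' f'"
  using has_pb assms unfolding has_pullbacks_of_def by blast

lemma stableD: "\<lbrakk>pullback_stable C T; is_pullback C f t t' f'; t \<in> T\<rbrakk> \<Longrightarrow> t' \<in> T"
  unfolding pullback_stable_def by blast

lemma S_pullback: "\<lbrakk>is_pullback C f t t' f'; t \<in> S\<rbrakk> \<Longrightarrow> t' \<in> S"
  by (rule stableD[OF S_stable])

lemma P_pullback: "\<lbrakk>is_pullback C p s s' p'; p \<in> P; s \<in> S\<rbrakk> \<Longrightarrow> p' \<in> P"
  using rel_stable unfolding relatively_stable_def by blast

text \<open>The legs \<open>s'\<close> and \<open>t'\<close> are pullbacks of
  \<open>S\<close>-morphisms, so \<open>S_cancel\<close> applies to
  \<open>t' \<cdot> w = s'\<close>.\<close>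

lemma conjugate_in_S:
  assumes "is_conjugate C S v c d w"
  shows "w \<in> S"
proof -
  obtain s' f' t' g' where "snd c \<in> S" "snd d \<in> S"
    and pb: "is_pullback C (fst c) (snd c) s' f'" "is_pullback C (fst d) (snd d) t' g'"
    and w: "w \<in> Hom C (Dom C s') (Dom C t')" "t' \<cdot> w = s'"
    using assms unfolding is_conjugate_def cospans_def by auto
  then show ?thesis
    by (intro S_cancel[of w t']) (auto simp: Hom_iff intro: S_pullback)
qed

text \<open>This makes \<open>S\<close> itself a member of the family whose intersection is
  \<open>S_circ\<close>, which is how \<open>S_circ\<close> is bounded by \<open>S\<close>.\<close>

lemma S_star_subset: "S_star C S \<subseteq> S"
  unfolding S_star_def using conjugate_in_S S_pullback by blast

lemma S_star_le_S_circ: "S_star C S \<subseteq> S_circ C P S"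
  unfolding S_circ_def by blast

lemma S_circ_subset: "S_circ C P S \<subseteq> S"
  using S_star_subset S_stable unfolding S_circ_def factor_stable_def by blast

lemma S_circ_stable: "pullback_stable C (S_circ C P S)"
  unfolding S_circ_def pullback_stable_def by blast

lemma S_circ_factor_stable:
  assumes "p \<in> P" "q \<in> P" "x \<in> S" "y \<in> S_circ C P S" "Dom C x = Cod C q" "Dom C p = Cod C y"
    "x \<cdot> q = p \<cdot> y"
  shows "x \<in> S_circ C P S"
  using assms unfolding S_circ_def factor_stable_def by blast

text \<open>\<open>w\<close> is the conjugate of \<open>s\<close>, viewed as a cospan morphism from \<open>\<langle>k, 1\<rangle>\<close> to \<open>\<langle>f, s\<rangle>\<close>, where
  \<open>k = f' \<cdot> w\<close>.\<close>

lemma section_in_S_circ: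
  assumes pb: "is_pullback C f s s' f'" and s [simp]: "s \<in> S"
    and w [simp]: "w \<in> Arr C" "Cod C w = Dom C s'"
    and eq: "s' \<cdot> w = Id C (Dom C w)"
  shows "w \<in> S_circ C P S"
proof -
  note [simp] = pullbackD(1-8)[OF pb]
  let ?k = "f' \<cdot> w"
  have dom: "Dom C w = Dom C f"
    using comp_simps(3)[of w s'] eq by simp
  have "s \<cdot> ?k = f \<cdot> (s' \<cdot> w)"
    by (rule comp_eq_extend[OF pullbackD(9)[OF pb], symmetric]) simp_all
  also have "\<dots> = f"
    by (simp add: eq dom)
  finally have sk: "s \<cdot> ?k = f" .
  have "is_pullback C ?k (Id C (Cod C ?k)) (Id C (Dom C ?k)) ?k"
    by (rule pullback_id) simp
  then have "\<exists>s0 f0 t' g'. is_pullback C ?k (Id C (Cod C ?k)) s0 f0 \<and> is_pullback C f s t' g' \<and>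
      w \<in> Hom C (Dom C s0) (Dom C t') \<and> t' \<cdot> w = s0 \<and> g' \<cdot> w = f0"
    using pb by (intro exI[of _ "Id C (Dom C ?k)"] exI[of _ ?k] exI[of _ s'] exI[of _ f'])
      (simp add: Hom_iff eq)
  then have "is_conjugate C S s (?k, Id C (Cod C ?k)) (f, s) w"
    unfolding is_conjugate_def by (simp add: cospans_def cospan_mor_def Hom_iff sk)
  \<comment> \<open>\<open>S_star\<close> consists of pullbacks of conjugates; the conjugate
    \<open>w\<close> is its own pullback along an identity.\<close>
  moreover have "is_pullback C (Id C (Cod C w)) w w (Id C (Dom C w))"
    using pullback_swap[OF pullback_id[of w]] by simp
  ultimately have "w \<in> S_star C S"
    unfolding S_star_def using s by blast
  then show ?thesis using S_star_le_S_circ by blast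
qed

text \<open>An identity is a section of the pullback of an identity along an identity; every other
  isomorphism follows by pullback stability. Hence isomorphic spans are
  \<open>zeq\<close>-equivalent.\<close>

lemma iso_S_circ:
  assumes "is_iso C i"
  shows "i \<in> S_circ C P S"
proof -
  have [simp]: "i \<in> Arr C" using assms by (simp add: is_iso_def)
  have "is_pullback C (Id C (Cod C i)) (Id C (Cod C i)) (Id C (Cod C i)) (Id C (Cod C i))"
    using pullback_id[of "Id C (Cod C i)"] by simp
  then have "Id C (Cod C i) \<in> S_circ C P S"
    by (rule section_in_S_circ) simp_all
  then show ?thesis
    by (rule stableD[OF S_circ_stable pullback_iso[OF assms]])
qed

section \<open>Composites and morphisms of spans\<close>

lemma span_iff: "(s, f) \<in> spans C S \<longleftrightarrow> s \<in> S \<and> f \<in> Arr C \<and> Dom C s = Dom C f"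
  by (simp add: spans_def)

lemma span_compsI:
  "is_pullback C f t t' f' \<Longrightarrow> (s \<cdot> t', g \<cdot> f') \<in> span_comps C (t, g) (s, f)"
  unfolding span_comps_def by auto

lemma span_compsE:
  assumes "c \<in> span_comps C (t, g) (s, f)"
  obtains t' f' where "is_pullback C f t t' f'" "c = (s \<cdot> t', g \<cdot> f')"
  using assms unfolding span_comps_def by auto

lemma span_comps_span:
  assumes "a \<in> spans C S" "b \<in> spans C S" "c \<in> span_comps C b a"
  shows "c \<in> spans C S" "Cod C (fst c) = Cod C (fst a)" "Cod C (snd c) = Cod C (snd b)"
    "Cod C (snd a) = Cod C (fst b)"
proof -
  obtain s f t g where ab: "a = (s, f)" "b = (t, g)" by fastforce
  obtain t' f' where pb: "is_pullback C f t t' f'" and c: "c = (s \<cdot> t', g \<cdot> f')"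
    using assms(3) unfolding ab by (rule span_compsE)
  have [simp]: "s \<in> S" "t \<in> S" "g \<in> Arr C" "Dom C s = Dom C f" "Dom C t = Dom C g"
    using assms(1,2) by (simp_all add: ab span_iff)
  note [simp] = pullbackD(1-8)[OF pb] S_pullback[OF pb]
  show "c \<in> spans C S" "Cod C (fst c) = Cod C (fst a)" "Cod C (snd c) = Cod C (snd b)"
    "Cod C (snd a) = Cod C (fst b)"
    by (simp_all add: ab c span_iff)
qed

lemma span_comps_exist:
  assumes "a \<in> spans C S" "b \<in> spans C S" "Cod C (snd a) = Cod C (fst b)"
  obtains c where "c \<in> span_comps C b a"
proof -
  obtain s f t g where ab: "a = (s, f)" "b = (t, g)" by fastforce
  obtain t' f' where "is_pullback C f t t' f'"
    using assms by (auto simp: ab span_iff elim: pullback_exists)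
  from span_compsI[OF this] that show thesis unfolding ab by blast
qed

lemma span_relI:
  assumes "(s, f) \<in> spans C S" "(t, g) \<in> spans C S" "x \<in> T" "x \<in> Arr C" "Dom C x = Dom C s"
    "Cod C x = Dom C t" "t \<cdot> x = s" "g \<cdot> x = f"
  shows "((s, f), (t, g)) \<in> span_rel C S T"
  using assms unfolding span_rel_def span_mor_def by (auto simp: Hom_iff)

lemma span_relE:
  assumes "((s, f), (t, g)) \<in> span_rel C S T"
  obtains x where "(s, f) \<in> spans C S" "(t, g) \<in> spans C S" "x \<in> T" "x \<in> Arr C"
    "Dom C x = Dom C s" "Cod C x = Dom C t" "t \<cdot> x = s" "g \<cdot> x = f"
  using assms unfolding span_rel_def span_mor_def by (auto simp: Hom_iff)

lemma span_rel_Cod: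
  assumes "(a, b) \<in> span_rel C S T"
  shows "Cod C (fst a) = Cod C (fst b)" "Cod C (snd a) = Cod C (snd b)"
proof -
  obtain s f t g where ab: "a = (s, f)" "b = (t, g)" by fastforce
  obtain x where "s \<in> S" "t \<in> S" "g \<in> Arr C" "f \<in> Arr C" "Dom C t = Dom C g" "x \<in> Arr C"
    "Cod C x = Dom C t" "t \<cdot> x = s" "g \<cdot> x = f"
    using assms unfolding ab by (auto simp: span_iff elim: span_relE)
  then show "Cod C (fst a) = Cod C (fst b)" "Cod C (snd a) = Cod C (snd b)"
    using comp_simps(3)[of x t] comp_simps(3)[of x g] by (simp_all add: ab)
qed

text \<open>With \<open>f = f1 \<cdot> x\<close>, the pullback of \<open>t\<close> along
  \<open>f\<close> factors through the one along \<open>f1\<close>. By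
  \<open>pullback_cancel\<close> the comparison \<open>y\<close> of the two composites is a pullback
  of \<open>x\<close>, hence again in \<open>T\<close>.\<close>

lemma span_rel_comps_right:
  assumes T: "pullback_stable C T" and rel: "(a, a') \<in> span_rel C S T" and b: "b \<in> spans C S"
    and c: "c \<in> span_comps C b a" and c': "c' \<in> span_comps C b a'"
  shows "(c, c') \<in> span_rel C S T"
proof -
  obtain s f s1 f1 t g where ab: "a = (s, f)" "a' = (s1, f1)" "b = (t, g)" by fastforce
  obtain x where sp: "(s, f) \<in> spans C S" "(s1, f1) \<in> spans C S"
    and x [simp]: "x \<in> T" "x \<in> Arr C" "Dom C x = Dom C s" "Cod C x = Dom C s1"
    and x': "s1 \<cdot> x = s" "f1 \<cdot> x = f"
    using rel unfolding ab by (rule span_relE)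
  have [simp]: "s \<in> S" "s1 \<in> S" "f \<in> Arr C" "f1 \<in> Arr C" "Dom C s = Dom C f" "Dom C s1 = Dom C f1"
    "t \<in> S" "g \<in> Arr C" "Dom C t = Dom C g"
    using sp b by (simp_all add: ab span_iff)
  obtain t' f' where pb: "is_pullback C f t t' f'" and c_eq: "c = (s \<cdot> t', g \<cdot> f')"
    using c unfolding ab by (rule span_compsE)
  obtain t1 h where pb1: "is_pullback C f1 t t1 h" and c'_eq: "c' = (s1 \<cdot> t1, g \<cdot> h)"
    using c' unfolding ab by (rule span_compsE)
  note [simp] = pullbackD(3,4,6-8)[OF pb] pullbackD(3,4,6-8)[OF pb1]
  obtain y where pby: "is_pullback C x t1 t' y" and y: "h \<cdot> y = f'"
    by (rule pullback_cancel[OF pb1 pb[folded x'(2)]]) simp_all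
  note [simp] = pullbackD(3,4,6,8)[OF pby]
  have yT: "y \<in> T"
    by (rule stableD[OF T pullback_swap[OF pby]]) simp
  show ?thesis
    unfolding c_eq c'_eq
  proof (rule span_relI[OF _ _ yT])
    show "(s \<cdot> t', g \<cdot> f') \<in> spans C S"
      using span_comps_span(1)[OF _ _ c] sp b by (simp add: ab c_eq)
    show "(s1 \<cdot> t1, g \<cdot> h) \<in> spans C S"
      using span_comps_span(1)[OF _ _ c'] sp b by (simp add: ab c'_eq)
    have "s1 \<cdot> (x \<cdot> t') = s \<cdot> t'"
      by (rule comp_eq_extend1[OF x'(1)]) simp_all
    then show "(s1 \<cdot> t1) \<cdot> y = s \<cdot> t'"
      using pullbackD(9)[OF pby] by simp
    show "(g \<cdot> h) \<cdot> y = g \<cdot> f'"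
      using y by simp
  qed simp_all
qed

text \<open>Here it is the \<open>S\<close>-leg that factors, as \<open>s = s1 \<cdot> x\<close>, so
  the squares are swapped before cancelling; the comparison \<open>y\<close> is a pullback of
  \<open>x\<close> along \<open>k\<close>.\<close>

lemma span_rel_comps_left:
  assumes T: "pullback_stable C T" and rel: "(b, b') \<in> span_rel C S T" and a: "a \<in> spans C S"
    and c: "c \<in> span_comps C b a" and c': "c' \<in> span_comps C b' a"
  shows "(c, c') \<in> span_rel C S T"
proof -
  obtain s f s1 f1 r h where ab: "b = (s, f)" "b' = (s1, f1)" "a = (r, h)" by fastforce
  obtain x where sp: "(s, f) \<in> spans C S" "(s1, f1) \<in> spans C S"
    and x [simp]: "x \<in> T" "x \<in> Arr C" "Dom C x = Dom C s" "Cod C x = Dom C s1"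
    and x': "s1 \<cdot> x = s" "f1 \<cdot> x = f"
    using rel unfolding ab by (rule span_relE)
  have [simp]: "s \<in> S" "s1 \<in> S" "f \<in> Arr C" "f1 \<in> Arr C" "Dom C s = Dom C f" "Dom C s1 = Dom C f1"
    "r \<in> S" "h \<in> Arr C" "Dom C r = Dom C h"
    using sp a by (simp_all add: ab span_iff)
  obtain s' h' where pb: "is_pullback C h s s' h'" and c_eq: "c = (r \<cdot> s', f \<cdot> h')"
    using c unfolding ab by (rule span_compsE)
  obtain t k where pb1: "is_pullback C h s1 t k" and c'_eq: "c' = (r \<cdot> t, f1 \<cdot> k)"
    using c' unfolding ab by (rule span_compsE)
  note [simp] = pullbackD(3,4,6-8)[OF pb] pullbackD(3,4,6-8)[OF pb1]
  obtain y where pby: "is_pullback C x k h' y" and y: "t \<cdot> y = s'"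
    by (rule pullback_cancel[OF pullback_swap[OF pb1] pullback_swap[OF pb, folded x'(1)]]) simp_all
  note [simp] = pullbackD(4,8)[OF pby]
  have [simp]: "Dom C y = Dom C s'" using pullbackD(6)[OF pby] by simp
  have yT: "y \<in> T"
    by (rule stableD[OF T pullback_swap[OF pby]]) simp
  show ?thesis
    unfolding c_eq c'_eq
  proof (rule span_relI[OF _ _ yT])
    show "(r \<cdot> s', f \<cdot> h') \<in> spans C S"
      using span_comps_span(1)[OF _ _ c] sp a by (simp add: ab c_eq)
    show "(r \<cdot> t, f1 \<cdot> k) \<in> spans C S"
      using span_comps_span(1)[OF _ _ c'] sp a by (simp add: ab c'_eq)
    have "f1 \<cdot> (x \<cdot> h') = f \<cdot> h'"
      by (rule comp_eq_extend1[OF x'(2)]) simp_all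
    then show "(f1 \<cdot> k) \<cdot> y = f \<cdot> h'"
      using pullbackD(9)[OF pby] by simp
    show "(r \<cdot> t) \<cdot> y = r \<cdot> s'"
      using y by simp
  qed simp_all
qed

section \<open>The quotient category\<close>

abbreviation "z \<equiv> zeq C P S"
abbreviation "I \<equiv> span_iso C S"
abbreviation "Z \<equiv> \<lambda>a. zclass C P S (fst a) (snd a)"

section \<open>The congruence property of \<open>zeq\<close>\<close>

lemma zeq_if_span_rel: "(a, b) \<in> span_rel C S (S_circ C P S) \<Longrightarrow> (a, b) \<in> z"
  unfolding span_rel_def by (auto intro: zeq.step)

lemma zeq_spans:
  assumes "(a, b) \<in> z"
  shows "a \<in> spans C S" "b \<in> spans C S"
  using assms by (induction rule: zeq.induct) auto

lemma zeq_Cod: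
  assumes "(a, b) \<in> z"
  shows "Cod C (fst a) = Cod C (fst b) \<and> Cod C (snd a) = Cod C (snd b)"
  using assms
proof (induction rule: zeq.induct)
  case (step a b x)
  then have "(a, b) \<in> span_rel C S (S_circ C P S)"
    unfolding span_rel_def by auto
  then show ?case using span_rel_Cod by blast
qed auto

lemma span_rel_refl:
  assumes "a \<in> spans C S" "\<And>i. is_iso C i \<Longrightarrow> i \<in> T"
  shows "(a, a) \<in> span_rel C S T"
proof -
  obtain s f where a: "a = (s, f)" by fastforce
  show ?thesis
    unfolding a
    by (rule span_relI[of _ _ _ _ "Id C (Dom C s)"])
      (use assms(1) assms(2)[OF is_iso_id[of "Dom C s"]] in \<open>auto simp: a span_iff\<close>)
qed

text \<open>Congruence applied to the identity morphism of \<open>a\<close> compares the composites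
  formed with two choices of pullback.\<close>

lemma span_comps_zeq_unique:
  assumes "a \<in> spans C S" "b \<in> spans C S" "c \<in> span_comps C b a" "c' \<in> span_comps C b a"
  shows "(c, c') \<in> z"
  using span_rel_comps_right[OF S_circ_stable span_rel_refl] iso_S_circ assms
  by (blast intro: zeq_if_span_rel)

text \<open>Induction on the generation of \<open>zeq\<close>, with the composites \<open>c\<close>
  and \<open>c'\<close> left arbitrary because each stage may use other pullbacks.\<close>

lemma zeq_comps_right:
  assumes "(a, a') \<in> z" "b \<in> spans C S" "c \<in> span_comps C b a" "c' \<in> span_comps C b a'"
  shows "(c, c') \<in> z"
  using assms
proof (induction arbitrary: c c' rule: zeq.induct)
  case (step a a' x)
  then have "(a, a') \<in> span_rel C S (S_circ C P S)"
    unfolding span_rel_def by auto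
  then show ?case
    using span_rel_comps_right[OF S_circ_stable _ step.prems] zeq_if_span_rel by blast
next
  case (refl a)
  then show ?case by (blast intro: span_comps_zeq_unique)
next
  case (sym a a')
  then show ?case by (blast intro: zeq.sym)
next
  case (trans a d a')
  \<comment> \<open>The intermediate span \<open>d\<close> comes without a composite; one exists
    because \<open>zeq\<close> preserves the ends of spans and \<open>a\<close> is composable with
    \<open>b\<close>.\<close>
  have "Cod C (snd d) = Cod C (fst b)"
    using zeq_Cod[OF trans.hyps(1)] span_comps_span(4)[OF zeq_spans(1)[OF trans.hyps(1)] trans.prems(1,2)]
    by simp
  then obtain e where "e \<in> span_comps C b d"
    using span_comps_exist zeq_spans(2)[OF trans.hyps(1)] trans.prems(1) by blast
  then show ?case
    using trans.IH trans.prems zeq.trans by blast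
qed

lemma zeq_comps_left:
  assumes "(b, b') \<in> z" "a \<in> spans C S" "c \<in> span_comps C b a" "c' \<in> span_comps C b' a"
  shows "(c, c') \<in> z"
  using assms
proof (induction arbitrary: c c' rule: zeq.induct)
  case (step b b' x)
  then have "(b, b') \<in> span_rel C S (S_circ C P S)"
    unfolding span_rel_def by auto
  then show ?case
    using span_rel_comps_left[OF S_circ_stable _ step.prems] zeq_if_span_rel by blast
next
  case (refl b)
  then show ?case by (blast intro: span_comps_zeq_unique)
next
  case (sym b b')
  then show ?case by (blast intro: zeq.sym)
next
  case (trans b d b')
  have "Cod C (snd a) = Cod C (fst d)"
    using zeq_Cod[OF trans.hyps(1)] span_comps_span(4)[OF trans.prems(1) zeq_spans(1)[OF trans.hyps(1)] trans.prems(2)]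
    by simp
  then obtain e where "e \<in> span_comps C d a"
    using span_comps_exist zeq_spans(2)[OF trans.hyps(1)] trans.prems(1) by blast
  then show ?case
    using trans.IH trans.prems zeq.trans by blast
qed

text \<open>One factor is changed at a time, passing through a composite of \<open>b\<close> with
  \<open>a'\<close>.\<close>

lemma zeq_comps:
  assumes a: "(a, a') \<in> z" and b: "(b, b') \<in> z"
    and c: "c \<in> span_comps C b a" "c' \<in> span_comps C b' a'"
  shows "(c, c') \<in> z"
proof -
  note sp = zeq_spans[OF a] zeq_spans[OF b]
  have "Cod C (snd a') = Cod C (fst b)"
    using zeq_Cod[OF a] span_comps_span(4)[OF sp(1,3) c(1)] by simp
  then obtain d where "d \<in> span_comps C b a'"
    using span_comps_exist sp by blast
  then show ?thesis
    using zeq_comps_right[OF a sp(3) c(1)] zeq_comps_left[OF b sp(2) _ c(2)] zeq.trans by blast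
qed

section \<open>Isomorphism classes of spans and their composition\<close>

lemma span_iso_trans:
  assumes "(a, b) \<in> I" "(b, c) \<in> I"
  shows "(a, c) \<in> I"
proof -
  obtain s f t g r h where abc: "a = (s, f)" "b = (t, g)" "c = (r, h)" by fastforce
  obtain x where x: "(s, f) \<in> spans C S" "x \<in> {i. is_iso C i}" "x \<in> Arr C" "Dom C x = Dom C s"
    "Cod C x = Dom C t" "t \<cdot> x = s" "g \<cdot> x = f"
    using assms(1) unfolding abc span_iso_eq by (rule span_relE)
  obtain y where y: "(t, g) \<in> spans C S" "(r, h) \<in> spans C S" "y \<in> {i. is_iso C i}" "y \<in> Arr C"
    "Dom C y = Dom C t" "Cod C y = Dom C r" "r \<cdot> y = t" "h \<cdot> y = g"
    using assms(2) unfolding abc span_iso_eq by (rule span_relE)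
  have [simp]: "r \<in> Arr C" "h \<in> Arr C" "Dom C r = Dom C h"
    using y(2) by (simp_all add: span_iff)
  show ?thesis
    unfolding abc span_iso_eq
  proof (rule span_relI[OF x(1) y(2)])
    show "y \<cdot> x \<in> {i. is_iso C i}"
      using x(2,5) y(3,5) by (simp add: is_iso_comp)
    show "r \<cdot> (y \<cdot> x) = s" "h \<cdot> (y \<cdot> x) = f"
      using comp_eq_extend1[OF y(7), of x] comp_eq_extend1[OF y(8), of x] x y by simp_all
  qed (use x y in simp_all)
qed

lemma span_iso_sym:
  assumes "(a, b) \<in> I"
  shows "(b, a) \<in> I"
proof -
  obtain s f t g where ab: "a = (s, f)" "b = (t, g)" by fastforce
  obtain x where x: "(s, f) \<in> spans C S" "(t, g) \<in> spans C S" "x \<in> {i. is_iso C i}" "x \<in> Arr C"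
    "Dom C x = Dom C s" "Cod C x = Dom C t" "t \<cdot> x = s" "g \<cdot> x = f"
    using assms unfolding ab span_iso_eq by (rule span_relE)
  obtain y where y: "y \<in> Arr C" "Dom C y = Cod C x" "Cod C y = Dom C x"
    "y \<cdot> x = Id C (Dom C x)" "x \<cdot> y = Id C (Cod C x)"
    using x(3) by (auto elim: is_isoE)
  have [simp]: "t \<in> Arr C" "g \<in> Arr C" "Dom C t = Dom C g"
    using x(2) by (simp_all add: span_iff)
  show ?thesis
    unfolding ab span_iso_eq
  proof (rule span_relI[OF x(2,1)])
    show "y \<in> {i. is_iso C i}"
      using is_isoI[of y x] x y by simp
    have "s \<cdot> y = t \<cdot> (x \<cdot> y)"
      by (rule comp_eq_extend1[OF x(7), symmetric]) (use x(4,6) y in simp_all)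
    then show "s \<cdot> y = t"
      unfolding y(5) x(6) by simp
    have "f \<cdot> y = g \<cdot> (x \<cdot> y)"
      by (rule comp_eq_extend1[OF x(8), symmetric]) (use x(4,6) y in simp_all)
    then show "f \<cdot> y = g"
      unfolding y(5) x(6) by simp
  qed (use x y in simp_all)
qed

lemma span_iso_equiv: "equiv (spans C S) I"
proof (rule equivI)
  show "I \<subseteq> spans C S \<times> spans C S"
    unfolding span_iso_def by auto
  show "refl_on (spans C S) I"
    unfolding refl_on_def span_iso_eq by (auto intro: span_rel_refl)
  show "sym I" by (rule symI) (rule span_iso_sym)
  show "trans I" by (rule transI) (rule span_iso_trans)
qed

lemma span_iso_zeq: "(a, b) \<in> I \<Longrightarrow> (a, b) \<in> z"
  unfolding span_iso_def by (auto intro: zeq.step iso_S_circ)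

lemma span_iso_comps:
  assumes a: "(a, a') \<in> I" and b: "(b, b') \<in> I"
    and c: "c \<in> span_comps C b a" "c' \<in> span_comps C b' a'"
  shows "(c, c') \<in> I"
proof -
  note sp = zeq_spans[OF span_iso_zeq[OF a]] zeq_spans[OF span_iso_zeq[OF b]]
  have "Cod C (snd a') = Cod C (fst b)"
    using zeq_Cod[OF span_iso_zeq[OF a]] span_comps_span(4)[OF sp(1,3) c(1)] by simp
  then obtain d where d: "d \<in> span_comps C b a'"
    using span_comps_exist sp by blast
  show ?thesis
    using span_rel_comps_right[OF is_iso_pullback_stable a[unfolded span_iso_eq] sp(3) c(1) d]
      span_rel_comps_left[OF is_iso_pullback_stable b[unfolded span_iso_eq] sp(2) d c(2)]
    unfolding span_iso_eq[symmetric] by (rule span_iso_trans)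
qed

text \<open>The union defining composition collapses: its members coincide by
  \<open>span_iso_comps\<close>, and \<open>c\<close> shows that there is one.\<close>

lemma Comp_Span:
  assumes a: "a \<in> spans C S" and b: "b \<in> spans C S" and c: "c \<in> span_comps C b a"
  shows "Comp (Span C S) (I `` {b}) (I `` {a}) = I `` {c}"
proof -
  have "Comp (Span C S) (I `` {b}) (I `` {a}) =
      \<Union>{I `` {c'} | a' b' c'. a' \<in> I `` {a} \<and> b' \<in> I `` {b} \<and> c' \<in> span_comps C b' a'}"
    unfolding Span_def span_comps_def by simp (rule arg_cong[where f = Union], force)
  also have "\<dots> = \<Union>{I `` {c}}"
  proof (rule arg_cong[where f = Union], intro equalityI subsetI)
    fix X assume "X \<in> {I `` {c'} | a' b' c'. a' \<in> I `` {a} \<and> b' \<in> I `` {b} \<and> c' \<in> span_comps C b' a'}"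
    then obtain a' b' c' where "(a, a') \<in> I" "(b, b') \<in> I" "c' \<in> span_comps C b' a'"
      and X: "X = I `` {c'}" by blast
    then have "(c, c') \<in> I" using span_iso_comps c by blast
    then show "X \<in> {I `` {c}}"
      using X equiv_class_eq[OF span_iso_equiv] by blast
  next
    fix X assume "X \<in> {I `` {c}}"
    moreover have "a \<in> I `` {a}" "b \<in> I `` {b}"
      using a b equiv_class_self[OF span_iso_equiv] by blast+
    ultimately show "X \<in> {I `` {c'} | a' b' c'. a' \<in> I `` {a} \<and> b' \<in> I `` {b} \<and> c' \<in> span_comps C b' a'}"
      using c by blast
  qed
  finally show ?thesis by simp
qed

text \<open>As \<open>span_iso\<close> is contained in \<open>zeq\<close>, the representatives
  provided by the definition of \<open>zeq_Span\<close> may be exchanged for \<open>a\<close> and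
  \<open>b\<close>.\<close>

lemma zeq_Span_class_iff:
  assumes "a \<in> spans C S" "b \<in> spans C S"
  shows "(I `` {a}, I `` {b}) \<in> zeq_Span C P S \<longleftrightarrow> (a, b) \<in> z"
proof
  assume "(I `` {a}, I `` {b}) \<in> zeq_Span C P S"
  then obtain x y where "(a, x) \<in> I" "(b, y) \<in> I" "(x, y) \<in> z"
    unfolding zeq_Span_def by blast
  then show "(a, b) \<in> z"
    using span_iso_zeq zeq.trans zeq.sym by metis
next
  assume "(a, b) \<in> z"
  moreover have "a \<in> I `` {a}" "b \<in> I `` {b}"
    using assms equiv_class_self[OF span_iso_equiv] by blast+
  moreover have "I `` {a} \<in> Arr (Span C S)" "I `` {b} \<in> Arr (Span C S)"
    using assms by (simp_all add: Span_def quotientI)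
  ultimately show "(I `` {a}, I `` {b}) \<in> zeq_Span C P S"
    unfolding zeq_Span_def by blast
qed

text \<open>An arrow of the quotient is a set of isomorphism classes. Describing it through the
  \<open>zeq\<close>-class of one span reduces the two-level quotient to reasoning about
  spans.\<close>

lemma zclass_eq_image:
  assumes "a \<in> spans C S"
  shows "Z a = (\<lambda>b. I `` {b}) ` (z `` {a})"
proof (intro equalityI subsetI)
  fix X assume "X \<in> Z a"
  then have X: "(I `` {a}, X) \<in> zeq_Span C P S" by (simp add: zclass_def)
  then have "X \<in> spans C S // I" by (simp add: zeq_Span_def Span_def)
  then obtain b where b: "b \<in> spans C S" "X = I `` {b}" by (rule quotientE)
  then show "X \<in> (\<lambda>b. I `` {b}) ` (z `` {a})"
    using X zeq_Span_class_iff[OF assms b(1)] by blast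
next
  fix X assume "X \<in> (\<lambda>b. I `` {b}) ` (z `` {a})"
  then obtain b where "(a, b) \<in> z" "X = I `` {b}" by blast
  then show "X \<in> Z a"
    using zeq_Span_class_iff[OF assms] zeq_spans by (simp add: zclass_def)
qed

lemma zclass_eq_iff:
  assumes "a \<in> spans C S" "b \<in> spans C S"
  shows "Z a = Z b \<longleftrightarrow> (a, b) \<in> z"
proof
  assume "Z a = Z b"
  moreover have "I `` {b} \<in> Z b"
    using zclass_eq_image[OF assms(2)] zeq.refl[OF assms(2)] by blast
  ultimately have "I `` {b} \<in> Z a" by simp
  then show "(a, b) \<in> z"
    using zeq_Span_class_iff[OF assms] by (simp add: zclass_def)
next
  assume "(a, b) \<in> z"
  then have "z `` {a} = z `` {b}"
    using zeq.sym zeq.trans by blast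
  then show "Z a = Z b"
    using zclass_eq_image assms by simp
qed

lemma zclass_cong: "(a, b) \<in> z \<Longrightarrow> Z a = Z b"
  using zclass_eq_iff zeq_spans by blast

section \<open>The structure of \<open>RaPar\<close> in terms of representing spans\<close>

lemma Obj_RaPar [simp]: "Obj (RaPar C P S) = Obj C"
  by (simp add: RaPar_def quotient_cat_def Span_def)

lemma Arr_RaPar: "Arr (RaPar C P S) = Z ` spans C S"
  unfolding RaPar_def quotient_cat_def Span_def zclass_def
  by (auto simp: quotient_def)

lemma Arr_RaParE:
  assumes "X \<in> Arr (RaPar C P S)"
  obtains s f where "s \<in> S" "f \<in> Arr C" "Dom C s = Dom C f" "X = zclass C P S s f"
  using assms unfolding Arr_RaPar by (auto simp: span_iff)

lemma Arr_RaParI [simp]: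
  "\<lbrakk>s \<in> S; f \<in> Arr C; Dom C s = Dom C f\<rbrakk> \<Longrightarrow> zclass C P S s f \<in> Arr (RaPar C P S)"
  unfolding Arr_RaPar by (rule image_eqI[of _ _ "(s, f)"]) (simp_all add: span_iff)

lemma Dom_Cod_Span:
  assumes "a \<in> spans C S"
  shows "Dom (Span C S) (I `` {a}) = Cod C (fst a)" "Cod (Span C S) (I `` {a}) = Cod C (snd a)"
proof -
  have ne: "I `` {a} \<noteq> {}"
    using assms equiv_class_self[OF span_iso_equiv] by blast
  have *: "Cod C (fst x) = Cod C (fst a)" "Cod C (snd x) = Cod C (snd a)" if "x \<in> I `` {a}" for x
    using that zeq_Cod[OF span_iso_zeq[of a x]] by simp_all
  show "Dom (Span C S) (I `` {a}) = Cod C (fst a)"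
    using the_elem_const[OF ne, of "\<lambda>(s, f). Cod C s"] *
    by (simp add: Span_def case_prod_unfold)
  show "Cod (Span C S) (I `` {a}) = Cod C (snd a)"
    using the_elem_const[OF ne, of "\<lambda>(s, f). Cod C f"] *
    by (simp add: Span_def case_prod_unfold)
qed

lemma Dom_Cod_RaPar [simp]:
  assumes "s \<in> S" "f \<in> Arr C" "Dom C s = Dom C f"
  shows "Dom (RaPar C P S) (zclass C P S s f) = Cod C s"
    "Cod (RaPar C P S) (zclass C P S s f) = Cod C f"
proof -
  have a: "(s, f) \<in> spans C S" using assms by (simp add: span_iff)
  have Z: "zclass C P S s f = (\<lambda>b. I `` {b}) ` (z `` {(s, f)})"
    using zclass_eq_image[OF a] by simp
  have ne: "zclass C P S s f \<noteq> {}"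
    unfolding Z using zeq.refl[OF a] by blast
  have *: "Dom (Span C S) X = Cod C s" "Cod (Span C S) X = Cod C f" if X: "X \<in> zclass C P S s f" for X
  proof -
    obtain b where b: "((s, f), b) \<in> z" "X = I `` {b}"
      using X unfolding Z by blast
    show "Dom (Span C S) X = Cod C s" "Cod (Span C S) X = Cod C f"
      using Dom_Cod_Span[OF zeq_spans(2)[OF b(1)]] zeq_Cod[OF b(1)] by (simp_all add: b(2))
  qed
  show "Dom (RaPar C P S) (zclass C P S s f) = Cod C s"
    "Cod (RaPar C P S) (zclass C P S s f) = Cod C f"
    unfolding RaPar_def quotient_cat_def using the_elem_const[OF ne *(1)] the_elem_const[OF ne *(2)]
    by simp_all
qed

lemma Id_RaPar: "Id (RaPar C P S) A = zclass C P S (Id C A) (Id C A)"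
  unfolding RaPar_def quotient_cat_def zclass_def Span_def by simp

text \<open>Any two members of the classes have representatives equivalent to \<open>a\<close> and
  \<open>b\<close>; the congruence \<open>zeq_comps\<close> makes all terms of the union equal to
  the class of \<open>c\<close>.\<close>

lemma Comp_RaPar_span:
  assumes a: "a \<in> spans C S" and b: "b \<in> spans C S" and c: "c \<in> span_comps C b a"
  shows "Comp (RaPar C P S) (Z b) (Z a) = Z c"
proof -
  have *: "zeq_Span C P S `` {Comp (Span C S) Y X} = Z c" if X: "X \<in> Z a" and Y: "Y \<in> Z b" for X Y
  proof -
    obtain a' where a': "(a, a') \<in> z" "X = I `` {a'}"
      using X unfolding zclass_eq_image[OF a] by blast
    obtain b' where b': "(b, b') \<in> z" "Y = I `` {b'}"
      using Y unfolding zclass_eq_image[OF b] by blast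
    note sp = zeq_spans(2)[OF a'(1)] zeq_spans(2)[OF b'(1)]
    have "Cod C (snd a') = Cod C (fst b')"
      using zeq_Cod[OF a'(1)] zeq_Cod[OF b'(1)] span_comps_span(4)[OF a b c] by simp
    then obtain c' where c': "c' \<in> span_comps C b' a'"
      using span_comps_exist sp by blast
    have "Z c = Z c'"
      using zeq_comps[OF a'(1) b'(1) c c'] by (rule zclass_cong)
    then show ?thesis
      using Comp_Span[OF sp c'] by (simp add: a' b' zclass_def)
  qed
  have "Z a \<noteq> {}" "Z b \<noteq> {}"
    unfolding zclass_eq_image[OF a] zclass_eq_image[OF b] using a b zeq.refl by blast+
  moreover have "Comp (RaPar C P S) (Z b) (Z a) =
      (\<Union>X \<in> Z a. \<Union>Y \<in> Z b. zeq_Span C P S `` {Comp (Span C S) Y X})"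
    unfolding RaPar_def quotient_cat_def by simp
  ultimately show ?thesis using * by simp
qed

lemma Comp_RaPar:
  assumes "s \<in> S" "f \<in> Arr C" "Dom C s = Dom C f" "t \<in> S" "g \<in> Arr C" "Dom C t = Dom C g"
    and "is_pullback C f t t' f'"
  shows "Comp (RaPar C P S) (zclass C P S t g) (zclass C P S s f) = zclass C P S (s \<cdot> t') (g \<cdot> f')"
  using Comp_RaPar_span[of "(s, f)" "(t, g)" "(s \<cdot> t', g \<cdot> f')"] span_compsI[of f t t' f' s g] assms
  by (simp add: span_iff)

section \<open>Restriction and range\<close>

lemma zclass_eqI:
  assumes "s \<in> S" "f \<in> Arr C" "Dom C s = Dom C f" "t \<in> S" "g \<in> Arr C" "Dom C t = Dom C g"
    and x: "x \<in> S_circ C P S" "Dom C x = Dom C s" "Cod C x = Dom C t" "t \<cdot> x = s" "g \<cdot> x = f"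
  shows "zclass C P S s f = zclass C P S t g"
proof -
  have "x \<in> S" using x(1) S_circ_subset by blast
  then have "((s, f), (t, g)) \<in> span_rel C S (S_circ C P S)"
    by (intro span_relI[of _ _ _ _ x]) (simp_all add: span_iff assms)
  from zclass_cong[OF zeq_if_span_rel[OF this]] show ?thesis by simp
qed

text \<open>The section is the lift of the cone formed by an identity and \<open>k\<close>;
  \<open>section_in_S_circ\<close> places it in \<open>S_circ\<close>.\<close>

lemma section_exists:
  assumes pb: "is_pullback C f s s' f'" and s: "s \<in> S" and k: "k \<in> Arr C" "Cod C k = Dom C s"
    and f: "s \<cdot> k = f"
  obtains w where "w \<in> S_circ C P S" "w \<in> Arr C" "Dom C w = Dom C f" "Cod C w = Dom C s'"
    "s' \<cdot> w = Id C (Dom C f)" "f' \<cdot> w = k"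
proof -
  have dom: "Dom C f = Dom C k"
    using comp_simps(2)[of k s] s k f by simp
  have f_arr: "f \<in> Arr C" by (rule pullbackD(1)[OF pb])
  have sq: "f \<cdot> Id C (Dom C f) = s \<cdot> k"
    unfolding f by (simp add: f_arr)
  obtain w where w: "w \<in> Arr C" "Dom C w = Dom C k" "Cod C w = Dom C s'"
    "s' \<cdot> w = Id C (Dom C f)" "f' \<cdot> w = k"
    by (rule pullback_lift[OF pb _ k(1) _ _ k(2) sq]) (simp_all add: f_arr dom k)
  have "w \<in> S_circ C P S"
    by (rule section_in_S_circ[OF pb s w(1,3)]) (simp add: w dom)
  then show thesis
    by (rule that) (simp_all add: w dom)
qed

text \<open>The diagonal \<open>d\<close> of the square satisfies
  \<open>d \<cdot> p = q \<cdot> x\<close>, so factor stability carries membership in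
  \<open>S_circ\<close> from \<open>x\<close> to \<open>d\<close>. An identity \<open>x\<close>
  compares two factorizations of one arrow; a general \<open>x\<close> compares the ranges of
  related spans.\<close>

lemma zclass_range_eqI:
  assumes ps [simp]: "p \<in> P" "s \<in> S" "Dom C s = Cod C p" and qt [simp]: "q \<in> P" "t \<in> S" "Dom C t = Cod C q"
    and x: "x \<in> S_circ C P S" "Dom C x = Dom C p" "Cod C x = Dom C q" and eq: "s \<cdot> p = t \<cdot> (q \<cdot> x)"
  shows "zclass C P S s s = zclass C P S t t"
proof -
  have [simp]: "x \<in> Arr C" using x(1) S_circ_subset S_arr by blast
  note [simp] = x(2,3)
  have "Cod C (s \<cdot> p) = Cod C (t \<cdot> (q \<cdot> x))" by (simp only: eq)
  then have [simp]: "Cod C s = Cod C t" by simp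
  obtain d where d: "d \<in> Arr C" "Dom C d = Cod C p" "Cod C d = Dom C t" "d \<cdot> p = q \<cdot> x" "t \<cdot> d = s"
    by (rule diagonal[OF ps(1) qt(2) _ _ _ _ _ _ eq[symmetric]]) simp_all
  \<comment> \<open>Factor stability speaks only of arrows already known to lie in \<open>S\<close>;
    \<open>t \<cdot> d = s\<close> yields this.\<close>
  have dS: "d \<in> S"
    by (rule S_cancel[OF d(1) qt(2)]) (simp_all add: d)
  have "d \<in> S_circ C P S"
    by (rule S_circ_factor_stable[OF qt(1) ps(1) dS x(1)]) (simp_all add: d)
  then show ?thesis
    by (rule zclass_eqI[rotated 6]) (simp_all add: d)
qed

text \<open>Well-definedness of the restriction: a generating \<open>x\<close> satisfies
  \<open>t \<cdot> x = s\<close>, hence is also a span morphism from \<open>(s, s)\<close> to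
  \<open>(t, t)\<close>.\<close>

lemma zeq_restr:
  assumes "(a, b) \<in> z"
  shows "zclass C P S (fst a) (fst a) = zclass C P S (fst b) (fst b)"
  using assms
proof (induction rule: zeq.induct)
  case (step a b x)
  obtain s f t g where ab: "a = (s, f)" "b = (t, g)" by fastforce
  have "((s, f), (t, g)) \<in> span_rel C S (S_circ C P S)"
    using step by (auto simp: ab span_rel_def)
  then obtain x where "s \<in> S" "t \<in> S" "x \<in> S_circ C P S" "Dom C x = Dom C s" "Cod C x = Dom C t"
    "t \<cdot> x = s"
    by (rule span_relE) (simp add: span_iff)
  then show ?case
    unfolding ab by (simp add: zclass_eqI[of _ _ _ _ x])
qed auto

text \<open>Well-definedness of the range: \<open>f = g \<cdot> x\<close> turns the two chosen
  factorizations into the square required by \<open>zclass_range_eqI\<close>.\<close>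

lemma zeq_range:
  assumes "(a, b) \<in> z"
  shows "zclass C P S (sf (snd a)) (sf (snd a)) = zclass C P S (sf (snd b)) (sf (snd b))"
  using assms
proof (induction rule: zeq.induct)
  case (step a b x)
  obtain s f t g where ab: "a = (s, f)" "b = (t, g)" by fastforce
  have "((s, f), (t, g)) \<in> span_rel C S (S_circ C P S)"
    using step by (auto simp: ab span_rel_def)
  then obtain x where g [simp]: "f \<in> Arr C" "g \<in> Arr C"
    and x: "x \<in> S_circ C P S" "x \<in> Arr C" "Dom C x = Dom C f" "Cod C x = Dom C g" "g \<cdot> x = f"
    by (rule span_relE) (simp add: span_iff)
  note [simp] = factE(1-3,5,6)[OF g(1)] factE(1-3,5,6)[OF g(2)]
  have "sf g \<cdot> (pf g \<cdot> x) = g \<cdot> x"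
    by (rule comp_eq_extend1[OF factE(4)]) (simp_all add: x)
  then have "sf f \<cdot> pf f = sf g \<cdot> (pf g \<cdot> x)"
    by (simp add: x factE(4))
  then have "zclass C P S (sf f) (sf f) = zclass C P S (sf g) (sf g)"
    by (rule zclass_range_eqI[rotated -1]) (simp_all add: x)
  then show ?case by (simp add: ab)
qed auto

text \<open>\<open>restr\<close> and \<open>rng\<close> must be functions on classes, so a span is
  chosen. \<open>zeq_restr\<close> and \<open>zeq_range\<close> remove the dependence on it; outside
  the arrows of \<open>RaPar\<close> the choice is arbitrary.\<close>

definition rep :: "('m \<times> 'm) set set \<Rightarrow> 'm \<times> 'm" where
  "rep X = (SOME a. a \<in> spans C S \<and> Z a = X)"

definition restr :: "('m \<times> 'm) set set \<Rightarrow> ('m \<times> 'm) set set" where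
  "restr X = zclass C P S (fst (rep X)) (fst (rep X))"

definition rng :: "('m \<times> 'm) set set \<Rightarrow> ('m \<times> 'm) set set" where
  "rng X = zclass C P S (sf (snd (rep X))) (sf (snd (rep X)))"

lemma rep_zeq:
  assumes "a \<in> spans C S"
  shows "(rep (Z a), a) \<in> z"
proof -
  have "rep (Z a) \<in> spans C S \<and> Z (rep (Z a)) = Z a"
    unfolding rep_def by (rule someI[of "\<lambda>b. b \<in> spans C S \<and> Z b = Z a" a]) (simp add: assms)
  then show ?thesis using zclass_eq_iff assms by blast
qed

lemma restr_zclass [simp]:
  assumes "s \<in> S" "f \<in> Arr C" "Dom C s = Dom C f"
  shows "restr (zclass C P S s f) = zclass C P S s s"
  using zeq_restr[OF rep_zeq[of "(s, f)"]] assms by (simp add: restr_def span_iff)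

lemma rng_zclass [simp]:
  assumes "s \<in> S" "f \<in> Arr C" "Dom C s = Dom C f"
  shows "rng (zclass C P S s f) = zclass C P S (sf f) (sf f)"
  using zeq_range[OF rep_zeq[of "(s, f)"]] assms by (simp add: rng_def span_iff)

section \<open>Verification of the axioms\<close>

abbreviation "K \<equiv> RaPar C P S"

lemma Hom_RaParE:
  assumes "X \<in> Hom K A B"
  obtains s f where "s \<in> S" "f \<in> Arr C" "Dom C s = Dom C f" "X = zclass C P S s f"
    "Cod C s = A" "Cod C f = B"
proof -
  have X: "X \<in> Arr K" "Dom K X = A" "Cod K X = B"
    using assms by (auto simp: Hom_def)
  obtain s f where sf: "s \<in> S" "f \<in> Arr C" "Dom C s = Dom C f" "X = zclass C P S s f"
    using X(1) by (rule Arr_RaParE)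
  then show thesis using X by (intro that[of s f]) auto
qed

lemma Hom_RaParI:
  "\<lbrakk>s \<in> S; f \<in> Arr C; Dom C s = Dom C f; Cod C s = A; Cod C f = B\<rbrakk> \<Longrightarrow> zclass C P S s f \<in> Hom K A B"
  by (auto simp: Hom_def)

lemma category_RaPar: "category K"
proof
  fix X assume "X \<in> Arr K"
  then obtain s f where "s \<in> S" "f \<in> Arr C" "Dom C s = Dom C f" "X = zclass C P S s f"
    by (rule Arr_RaParE)
  then show "Dom K X \<in> Obj K" "Cod K X \<in> Obj K" by simp_all
next
  fix A assume "A \<in> Obj K"
  then show "Id K A \<in> Hom K A A"
    unfolding Id_RaPar by (intro Hom_RaParI) simp_all
next
  fix X Y A B D assume "X \<in> Hom K A B" "Y \<in> Hom K B D"
  then obtain s f t g where X [simp]: "s \<in> S" "f \<in> Arr C" "Dom C s = Dom C f"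
    and Y [simp]: "t \<in> S" "g \<in> Arr C" "Dom C t = Dom C g"
    and XY: "X = zclass C P S s f" "Y = zclass C P S t g"
    and [simp]: "Cod C s = A" "Cod C f = B" "Cod C t = B" "Cod C g = D"
    by (elim Hom_RaParE)
  obtain t' f' where pb: "is_pullback C f t t' f'"
    by (rule pullback_exists[of f t]) simp_all
  note [simp] = pullbackD(3,4,6-8)[OF pb] S_pullback[OF pb]
  show "Comp K Y X \<in> Hom K A D"
    unfolding XY Comp_RaPar[OF X Y pb] by (rule Hom_RaParI) simp_all
next
  fix X Y W A B D E assume "X \<in> Hom K A B" "Y \<in> Hom K B D" "W \<in> Hom K D E"
  then obtain s f t g r h where X [simp]: "s \<in> S" "f \<in> Arr C" "Dom C s = Dom C f"
    and Y [simp]: "t \<in> S" "g \<in> Arr C" "Dom C t = Dom C g"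
    and W [simp]: "r \<in> S" "h \<in> Arr C" "Dom C r = Dom C h"
    and XYW: "X = zclass C P S s f" "Y = zclass C P S t g" "W = zclass C P S r h"
    and [simp]: "Cod C s = A" "Cod C f = B" "Cod C t = B" "Cod C g = D" "Cod C r = D" "Cod C h = E"
    by (elim Hom_RaParE)
  obtain t' f' where pb1: "is_pullback C f t t' f'"
    by (rule pullback_exists[of f t]) simp_all
  note [simp] = pullbackD(3,4,6-8)[OF pb1] S_pullback[OF pb1]
  obtain r' g' where pb2: "is_pullback C g r r' g'"
    by (rule pullback_exists[of g r]) simp_all
  note [simp] = pullbackD(3,4,6-8)[OF pb2] S_pullback[OF pb2]
  obtain r'' f'' where pb3: "is_pullback C f' r' r'' f''"
    by (rule pullback_exists[of f' r']) simp_all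
  note [simp] = pullbackD(3,4,6-8)[OF pb3] S_pullback[OF pb3]
  \<comment> \<open>Both bracketings are computed from the same three squares by pasting in the two
    directions, so the resulting spans agree up to associativity in \<open>C\<close>.\<close>
  have pb4: "is_pullback C (g \<cdot> f') r r'' (g' \<cdot> f'')"
    by (rule pullback_paste[OF pb2 pb3])
  have pb5: "is_pullback C f (t \<cdot> r') (t' \<cdot> r'') f''"
    by (rule pullback_swap[OF pullback_paste[OF pullback_swap[OF pb1] pullback_swap[OF pb3]]])
  have "Comp K (Comp K W Y) X = zclass C P S (s \<cdot> (t' \<cdot> r'')) ((h \<cdot> g') \<cdot> f'')"
    unfolding XYW Comp_RaPar[OF Y W pb2] by (rule Comp_RaPar[OF X _ _ _ pb5]) simp_all
  moreover have "Comp K W (Comp K Y X) = zclass C P S ((s \<cdot> t') \<cdot> r'') (h \<cdot> (g' \<cdot> f''))"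
    unfolding XYW Comp_RaPar[OF X Y pb1] by (rule Comp_RaPar[OF _ _ _ W pb4]) simp_all
  ultimately show "Comp K (Comp K W Y) X = Comp K W (Comp K Y X)" by simp
next
  fix X A B assume "X \<in> Hom K A B"
  then obtain s f where X [simp]: "s \<in> S" "f \<in> Arr C" "Dom C s = Dom C f" "Cod C s = A" "Cod C f = B"
    and X_eq: "X = zclass C P S s f"
    by (elim Hom_RaParE)
  have A [simp]: "A \<in> Obj C" "B \<in> Obj C"
    using Dom_Cod_Obj(2)[of s] Dom_Cod_Obj(2)[of f] by simp_all
  have pb: "is_pullback C (Id C A) s s (Id C (Dom C s))"
    using pullback_swap[OF pullback_id[of s]] by simp
  show "Comp K X (Id K A) = X"
    unfolding X_eq Id_RaPar by (subst Comp_RaPar[OF _ _ _ _ _ _ pb]) simp_all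
  have pb: "is_pullback C f (Id C B) (Id C (Dom C f)) f"
    using pullback_id[of f] by simp
  show "Comp K (Id K B) X = X"
    unfolding X_eq Id_RaPar by (subst Comp_RaPar[OF _ _ _ _ _ _ pb]) simp_all
qed

lemma restriction_RaPar: "restriction_category K restr"
proof (intro restriction_category.intro category_RaPar restriction_category_axioms.intro)
  fix X A B assume "X \<in> Hom K A B"
  then obtain s f where "s \<in> S" "f \<in> Arr C" "Dom C s = Dom C f" "Cod C s = A" "Cod C f = B"
    "X = zclass C P S s f"
    by (elim Hom_RaParE)
  then show "restr X \<in> Hom K A A"
    by (simp add: Hom_RaParI)
next
  fix X assume "X \<in> Arr K"
  then obtain s f where X [simp]: "s \<in> S" "f \<in> Arr C" "Dom C s = Dom C f"
    and X_eq: "X = zclass C P S s f"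
    by (rule Arr_RaParE)
  obtain t' f' where pb: "is_pullback C s s t' f'"
    by (rule pullback_exists[of s s]) simp_all
  note [simp] = pullbackD(3,4,6-8)[OF pb] S_pullback[OF pb]
  \<comment> \<open>R1: \<open>w\<close> is the diagonal of the pullback of \<open>s\<close> along
    itself and maps \<open>(s, f)\<close> to the composite.\<close>
  obtain w where w: "w \<in> S_circ C P S" "w \<in> Arr C" "Dom C w = Dom C s" "Cod C w = Dom C t'"
    "t' \<cdot> w = Id C (Dom C s)" "f' \<cdot> w = Id C (Dom C s)"
    by (rule section_exists[OF pb, of "Id C (Dom C s)"]) simp_all
  have "Comp K X (restr X) = zclass C P S (s \<cdot> t') (f \<cdot> f')"
    unfolding X_eq restr_zclass[OF X] by (rule Comp_RaPar[OF _ _ _ X pb]) simp_all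
  also have "\<dots> = X"
    unfolding X_eq by (rule zclass_eqI[symmetric, OF _ _ _ _ _ _ w(1)]) (simp_all add: w)
  finally show "Comp K X (restr X) = X" .
next
  fix X Y assume XY: "X \<in> Arr K" "Y \<in> Arr K" "Dom K X = Dom K Y"
  obtain s f where X [simp]: "s \<in> S" "f \<in> Arr C" "Dom C s = Dom C f"
    and X_eq: "X = zclass C P S s f"
    using XY(1) by (rule Arr_RaParE)
  obtain t g where Y [simp]: "t \<in> S" "g \<in> Arr C" "Dom C t = Dom C g"
    and Y_eq: "Y = zclass C P S t g"
    using XY(2) by (rule Arr_RaParE)
  have "Cod C s = Cod C t"
    using XY(3) by (simp add: X_eq Y_eq)
  then obtain t' s' where pb: "is_pullback C s t t' s'"
    by - (rule pullback_exists[of s t], simp_all)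
  note [simp] = pullbackD(3,4,6-8)[OF pb] S_pullback[OF pb] S_pullback[OF pullback_swap[OF pb]]
  \<comment> \<open>One pullback of \<open>s\<close> and \<open>t\<close> serves R2 and R3: read in
    either direction it gives the same diagonal span, whose leg is also the first leg of
    \<open>Y\<close> composed with \<open>restr X\<close>.\<close>
  have "Comp K (restr Y) (restr X) = zclass C P S (s \<cdot> t') (t \<cdot> s')"
    unfolding X_eq Y_eq restr_zclass[OF X] restr_zclass[OF Y]
    by (rule Comp_RaPar[OF _ _ _ _ _ _ pb]) simp_all
  also have "\<dots> = zclass C P S (s \<cdot> t') (s \<cdot> t')"
    by (simp only: pullbackD(9)[OF pb])
  finally have YX: "Comp K (restr Y) (restr X) = zclass C P S (s \<cdot> t') (s \<cdot> t')" .
  have "Comp K (restr X) (restr Y) = zclass C P S (t \<cdot> s') (s \<cdot> t')"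
    unfolding X_eq Y_eq restr_zclass[OF X] restr_zclass[OF Y]
    by (rule Comp_RaPar[OF _ _ _ _ _ _ pullback_swap[OF pb]]) simp_all
  also have "\<dots> = zclass C P S (s \<cdot> t') (s \<cdot> t')"
    by (simp only: pullbackD(9)[OF pb])
  finally show "Comp K (restr X) (restr Y) = Comp K (restr Y) (restr X)"
    using YX by simp
  have "Comp K Y (restr X) = zclass C P S (s \<cdot> t') (g \<cdot> s')"
    unfolding X_eq Y_eq restr_zclass[OF X] by (rule Comp_RaPar[OF _ _ _ Y pb]) simp_all
  then show "restr (Comp K Y (restr X)) = Comp K (restr Y) (restr X)"
    using YX by simp
next
  fix X Y assume XY: "X \<in> Arr K" "Y \<in> Arr K" "Cod K X = Dom K Y"
  obtain s f where X [simp]: "s \<in> S" "f \<in> Arr C" "Dom C s = Dom C f"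
    and X_eq: "X = zclass C P S s f"
    using XY(1) by (rule Arr_RaParE)
  obtain t g where Y [simp]: "t \<in> S" "g \<in> Arr C" "Dom C t = Dom C g"
    and Y_eq: "Y = zclass C P S t g"
    using XY(2) by (rule Arr_RaParE)
  have "Cod C f = Cod C t"
    using XY(3) by (simp add: X_eq Y_eq)
  then obtain t' f' where pb: "is_pullback C f t t' f'"
    by - (rule pullback_exists[of f t], simp_all)
  note [simp] = pullbackD(3,4,6-8)[OF pb] S_pullback[OF pb]
  obtain u v where pb2: "is_pullback C (s \<cdot> t') s u v"
    by (rule pullback_exists[of "s \<cdot> t'" s]) simp_all
  have [simp]: "Cod C u = Dom C t'"
    using pullbackD(7)[OF pb2] by simp
  note [simp] = pullbackD(3,4,6,8)[OF pb2] S_pullback[OF pb2]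
  \<comment> \<open>R4: \<open>s \<cdot> t'\<close> factors through \<open>s\<close> by
    \<open>t'\<close>, and the induced section compares \<open>(s \<cdot> t', f \<cdot> t')\<close>
    with the composite of \<open>X\<close> and the restriction.\<close>
  obtain w where w: "w \<in> S_circ C P S" "w \<in> Arr C" "Dom C w = Dom C (s \<cdot> t')" "Cod C w = Dom C u"
    "u \<cdot> w = Id C (Dom C (s \<cdot> t'))" "v \<cdot> w = t'"
    by (rule section_exists[OF pb2, of t']) simp_all
  have "Comp K Y X = zclass C P S (s \<cdot> t') (g \<cdot> f')"
    unfolding X_eq Y_eq by (rule Comp_RaPar[OF X Y pb])
  then have rYX: "restr (Comp K Y X) = zclass C P S (s \<cdot> t') (s \<cdot> t')"
    by simp
  have "Comp K X (restr (Comp K Y X)) = zclass C P S ((s \<cdot> t') \<cdot> u) (f \<cdot> v)"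
    unfolding rYX unfolding X_eq by (rule Comp_RaPar[OF _ _ _ X pb2]) simp_all
  also have "\<dots> = zclass C P S (s \<cdot> t') (f \<cdot> t')"
    by (rule zclass_eqI[symmetric, OF _ _ _ _ _ _ w(1)]) (use w in simp_all)
  also have "\<dots> = zclass C P S (s \<cdot> t') (t \<cdot> f')"
    by (simp only: pullbackD(9)[OF pb])
  also have "\<dots> = Comp K (restr Y) X"
    unfolding X_eq Y_eq restr_zclass[OF Y] by (rule Comp_RaPar[OF X _ _ _ pb, symmetric]) simp_all
  finally show "Comp K (restr Y) X = Comp K X (restr (Comp K Y X))" by simp
qed

lemma split_restriction_RaPar: "split_restriction_category K restr"
proof (intro split_restriction_category.intro restriction_RaPar split_restriction_category_axioms.intro)
  fix e assume e: "e \<in> Arr K" "restr e = e"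
  obtain s f where X [simp]: "s \<in> S" "f \<in> Arr C" "Dom C s = Dom C f"
    and "e = zclass C P S s f"
    using e(1) by (rule Arr_RaParE)
  \<comment> \<open>A restriction idempotent equals its own restriction, so its second leg may be
    taken to be \<open>s\<close>.\<close>
  then have e_eq: "e = zclass C P S s s"
    using e(2) restr_zclass[OF X] by simp
  let ?D = "Dom C s"
  let ?m = "zclass C P S (Id C ?D) s" and ?r = "zclass C P S s (Id C ?D)"
  have [simp]: "?D \<in> Obj C" by simp
  have "is_pullback C (Id C ?D) (Id C ?D) (Id C ?D) (Id C ?D)"
    using pullback_id[of "Id C ?D"] by simp
  then have "Comp K ?m ?r = zclass C P S (s \<cdot> Id C ?D) (s \<cdot> Id C ?D)"
    by - (rule Comp_RaPar, simp_all)
  then have mr: "e = Comp K ?m ?r"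
    by (simp add: e_eq)
  obtain t' f' where pb: "is_pullback C s s t' f'"
    by (rule pullback_exists[of s s]) simp_all
  note [simp] = pullbackD(3,4,6-8)[OF pb] S_pullback[OF pb]
  obtain w where w: "w \<in> S_circ C P S" "w \<in> Arr C" "Dom C w = ?D" "Cod C w = Dom C t'"
    "t' \<cdot> w = Id C ?D" "f' \<cdot> w = Id C ?D"
    by (rule section_exists[OF pb, of "Id C ?D"]) simp_all
  have "Comp K ?r ?m = zclass C P S (Id C ?D \<cdot> t') (Id C ?D \<cdot> f')"
    by (rule Comp_RaPar[OF _ _ _ _ _ _ pb]) simp_all
  also have "\<dots> = zclass C P S t' f'"
    by simp
  also have "\<dots> = zclass C P S (Id C ?D) (Id C ?D)"
    by (rule zclass_eqI[symmetric, OF _ _ _ _ _ _ w(1)]) (use w in simp_all)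
  finally have rm: "Comp K ?r ?m = Id K ?D"
    by (simp add: Id_RaPar)
  have "?m \<in> Hom K ?D (Dom K e)" "?r \<in> Hom K (Dom K e) ?D"
    unfolding e_eq by (rule Hom_RaParI; simp)+
  then show "\<exists>X. \<exists>m \<in> Hom K X (Dom K e). \<exists>r \<in> Hom K (Dom K e) X.
      X \<in> Obj K \<and> e = Comp K m r \<and> Comp K r m = Id K X"
    using mr rm by (intro exI[of _ ?D] bexI[of _ ?m] bexI[of _ ?r]) simp_all
qed

lemma range_RaPar: "range_category K restr rng"
proof (intro range_category.intro restriction_RaPar range_category_axioms.intro)
  fix X A B assume "X \<in> Hom K A B"
  then obtain s f where X: "s \<in> S" "f \<in> Arr C" "Dom C s = Dom C f" "Cod C s = A" "Cod C f = B"
    "X = zclass C P S s f"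
    by (elim Hom_RaParE)
  then show "rng X \<in> Hom K B B"
    by (simp add: Hom_RaParI factE)
next
  fix X assume "X \<in> Arr K"
  then obtain s f where X [simp]: "s \<in> S" "f \<in> Arr C" "Dom C s = Dom C f"
    and X_eq: "X = zclass C P S s f"
    by (rule Arr_RaParE)
  note [simp] = factE(1-3,5,6)[OF X(2)]
  show "restr (rng X) = rng X"
    by (simp add: X_eq)
  obtain t' f' where pb: "is_pullback C f (sf f) t' f'"
    by (rule pullback_exists[of f "sf f"]) simp_all
  note [simp] = pullbackD(3,4,6-8)[OF pb] S_pullback[OF pb]
  \<comment> \<open>RR2: the section induced by \<open>pf f\<close> maps \<open>(s, f)\<close> to
    the composite with its range.\<close>
  obtain w where w: "w \<in> S_circ C P S" "w \<in> Arr C" "Dom C w = Dom C f" "Cod C w = Dom C t'"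
    "t' \<cdot> w = Id C (Dom C f)" "f' \<cdot> w = pf f"
    by (rule section_exists[OF pb, of "pf f"]) (simp_all add: factE(4)[OF X(2)])
  have "Comp K (rng X) X = zclass C P S (s \<cdot> t') (sf f \<cdot> f')"
    unfolding X_eq rng_zclass[OF X] by (rule Comp_RaPar[OF X _ _ _ pb]) simp_all
  also have "\<dots> = X"
    unfolding X_eq by (rule zclass_eqI[symmetric, OF _ _ _ _ _ _ w(1)]) (simp_all add: w factE(4)[OF X(2)])
  finally show "Comp K (rng X) X = X" .
next
  fix X Y assume XY: "X \<in> Arr K" "Y \<in> Arr K" "Cod K X = Dom K Y"
  obtain s f where X [simp]: "s \<in> S" "f \<in> Arr C" "Dom C s = Dom C f"
    and X_eq: "X = zclass C P S s f"
    using XY(1) by (rule Arr_RaParE)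
  obtain t g where Y [simp]: "t \<in> S" "g \<in> Arr C" "Dom C t = Dom C g"
    and Y_eq: "Y = zclass C P S t g"
    using XY(2) by (rule Arr_RaParE)
  note [simp] = factE(1-3,5,6)[OF X(2)]
  have [simp]: "Cod C f = Cod C t"
    using XY(3) by (simp add: X_eq Y_eq)
  obtain t2 s2 where pb: "is_pullback C (sf f) t t2 s2"
    by (rule pullback_exists[of "sf f" t]) simp_all
  note [simp] = pullbackD(3,4,6-8)[OF pb] S_pullback[OF pb]
  \<comment> \<open>Pulling \<open>t\<close> back along \<open>f\<close> in two stages keeps the
    factorization visible: \<open>p1\<close> lies in \<open>P\<close>, being a pullback of
    \<open>pf f\<close> along the \<open>S\<close>-morphism \<open>t2\<close>.\<close>
  obtain t1 p1 where pb': "is_pullback C (pf f) t2 t1 p1"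
    by (rule pullback_exists[of "pf f" t2]) simp_all
  note [simp] = pullbackD(3,4,6-8)[OF pb'] S_pullback[OF pb'] P_pullback[OF pb']
  have pb'': "is_pullback C f t t1 (s2 \<cdot> p1)"
    using pullback_paste[OF pb pb'] by (simp add: factE(4)[OF X(2)])
  show "rng (Comp K (restr Y) X) = Comp K (restr Y) (rng X)"
  proof -
    let ?h = "t \<cdot> (s2 \<cdot> p1)"
    have h [simp]: "?h \<in> Arr C" by simp
    note [simp] = factE(1-3,5,6)[OF h]
    have "Comp K (restr Y) X = zclass C P S (s \<cdot> t1) ?h"
      unfolding X_eq Y_eq restr_zclass[OF Y] by (rule Comp_RaPar[OF X _ _ _ pb'']) simp_all
    then have "rng (Comp K (restr Y) X) = zclass C P S (sf ?h) (sf ?h)"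
      by simp
    \<comment> \<open>RR3: \<open>t \<cdot> s2 = sf f \<cdot> t2\<close> is in \<open>S\<close>, so
      \<open>t \<cdot> s2\<close> and \<open>p1\<close> factorize \<open>?h\<close>; an identity as
      \<open>x\<close> compares this with the chosen factorization.\<close>
    also have "\<dots> = zclass C P S (t \<cdot> s2) (t \<cdot> s2)"
    proof (rule zclass_range_eqI)
      show "t \<cdot> s2 \<in> S"
        unfolding pullbackD(9)[OF pb, symmetric] by simp
      show "Id C (Dom C p1) \<in> S_circ C P S"
        by (intro iso_S_circ is_iso_id) simp
      show "sf ?h \<cdot> pf ?h = (t \<cdot> s2) \<cdot> (p1 \<cdot> Id C (Dom C p1))"
        unfolding factE(4)[OF h] by simp
    qed simp_all
    also have "\<dots> = zclass C P S (sf f \<cdot> t2) (t \<cdot> s2)"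
      by (simp only: pullbackD(9)[OF pb])
    also have "\<dots> = Comp K (restr Y) (rng X)"
      unfolding X_eq Y_eq restr_zclass[OF Y] rng_zclass[OF X]
      by (rule Comp_RaPar[OF _ _ _ _ _ _ pb, symmetric]) simp_all
    finally show ?thesis .
  qed
  show "rng (Comp K Y (rng X)) = rng (Comp K Y X)"
  proof -
    let ?h = "g \<cdot> (s2 \<cdot> p1)" and ?k = "g \<cdot> s2"
    have h [simp]: "?h \<in> Arr C" and k [simp]: "?k \<in> Arr C" by simp_all
    note [simp] = factE(1-3,5,6)[OF h] factE(1-3,5,6)[OF k]
    have "Comp K Y X = zclass C P S (s \<cdot> t1) ?h"
      unfolding X_eq Y_eq by (rule Comp_RaPar[OF X Y pb''])
    then have "rng (Comp K Y X) = zclass C P S (sf ?h) (sf ?h)"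
      by simp
    \<comment> \<open>RR4: \<open>?h\<close> is \<open>?k \<cdot> p1\<close>, and
      \<open>pf ?k \<cdot> p1\<close> is in \<open>P\<close>, so \<open>sf ?k\<close> is the
      \<open>S\<close>-part of a factorization of \<open>?h\<close> as well.\<close>
    also have "\<dots> = zclass C P S (sf ?k) (sf ?k)"
    proof (rule zclass_range_eqI[of "pf ?h" _ "pf ?k \<cdot> p1"])
      show "pf ?k \<cdot> p1 \<in> P"
        by (rule P_comp) simp_all
      show "Id C (Dom C p1) \<in> S_circ C P S"
        by (intro iso_S_circ is_iso_id) simp
      have "sf ?k \<cdot> (pf ?k \<cdot> p1) = ?k \<cdot> p1"
        by (rule comp_eq_extend1[OF factE(4)[OF k]]) simp_all
      then show "sf ?h \<cdot> pf ?h = sf ?k \<cdot> ((pf ?k \<cdot> p1) \<cdot> Id C (Dom C p1))"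
        unfolding factE(4)[OF h] by simp
    qed simp_all
    also have "\<dots> = rng (zclass C P S (sf f \<cdot> t2) ?k)"
      by simp
    also have "zclass C P S (sf f \<cdot> t2) ?k = Comp K Y (rng X)"
      unfolding X_eq Y_eq rng_zclass[OF X] by (rule Comp_RaPar[OF _ _ _ Y pb, symmetric]) simp_all
    finally show ?thesis by simp
  qed
qed

end

theorem theorem7:
  fixes C :: "('o, 'm) cat"
    and P S :: "'m set"
    and sf pf :: "'m \<Rightarrow> 'm"
  assumes "category C"
    and "has_pullbacks_of C S"
    and "pullback_stable C S"
    and "orthogonal_factorization_system C P S"
    and "relatively_stable C P S"
    and "\<And>f. f \<in> Arr C \<Longrightarrow> is_factorization C P S f (sf f) (pf f)"
  shows "\<exists>rs rg.
    (\<forall>(s, f) \<in> spans C S. rs (zclass C P S s f) = zclass C P S s s) \<and>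
    (\<forall>(s, f) \<in> spans C S. rg (zclass C P S s f) = zclass C P S (sf f) (sf f)) \<and>
    split_range_category (RaPar C P S) rs rg"
proof -
  interpret stable_factorization C P S sf pf
    using assms by (intro stable_factorization.intro stable_factorization_axioms.intro)
  show ?thesis
    by (intro exI[of _ restr] exI[of _ rng] conjI split_range_category.intro range_RaPar
      split_restriction_RaPar) (auto simp: span_iff)
qed

end
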